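(* Consider the energy $W:\mathrm{GL}^+(3)\to\mathbb{R}$, $W(F)=\|\operatorname{dev}_3\log U\|^2$ with $U=\sqrt{F^TF}$. The maximal ellipticity domain of $W$ contains the ellipticity domain described by $$\mathcal{E}_3=\left\{U\in\mathrm{PSym}(3)\;\Big|\;\|\operatorname{dev}_3\log U\|^2\le\frac23\right\};$$ that is, $W$ is Legendre-Hadamard elliptic at every $F\in\mathrm{GL}^+(3)$ such that $U=\sqrt{F^TF}\in\mathcal{E}_3$.
   Context: $\mathrm{GL}^+(n)=\{X\in\mathbb{R}^{n\times n}\mid\det X>0\}$, and $\mathrm{PSym}(n)$ is the set of symmetric positive definite real $n\times n$ matrices. For $F\in\mathrm{GL}^+(n)$, $U=\sqrt{F^TF}\in\mathrm{PSym}(n)$ is the right stretch tensor, and $\log U$ is the principal (symmetric) matrix logarithm of $U$. For $X\in\mathbb{R}^{n\times n}$, $\operatorname{dev}_nX=X-\frac1n\operatorname{tr}(X)\,\mathbb{1}$, where $\mathbb{1}$ is the identity matrix, and $\|X\|^2=\operatorname{tr}(X^TX)$ is the squared Frobenius norm. A $C^2$ function $W:\mathrm{GL}^+(n)\to\mathbb{R}$ is called Legendre-Hadamard elliptic at $F\in\mathrm{GL}^+(n)$ if $$D_F^2W(F).(\xi\otimes\eta,\xi\otimes\eta)\ge0\quad\text{for all }\xi,\eta\in\mathbb{R}^n,$$ where $D_F^2W(F)$ is the second derivative of $W$ at $F$ (a bilinear form on $\mathbb{R}^{n\times n}$) and $\xi\otimes\eta=\xi\eta^T$. A set $\mathcal{E}\subset\mathrm{GL}^+(n)$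 is an ellipticity domain for $W$ if $W$ is Legendre-Hadamard elliptic at every $F\in\mathcal{E}$; the maximal ellipticity domain of $W$ is the set of all $F\in\mathrm{GL}^+(n)$ at which $W$ is Legendre-Hadamard elliptic. A set of stretch tensors $U\in\mathrm{PSym}(n)$ describes a subset of $\mathrm{GL}^+(n)$, namely the set of all $F\in\mathrm{GL}^+(n)$ for which $\sqrt{F^TF}$ belongs to the given set. *)

theory Defs
  imports "HOL-Analysis.Analysis"
begin

definition GL_plus :: "(real^'n^'n) set" where
  "GL_plus = {X. det X > 0}"

definition PSym :: "(real^'n^'n) set" where
  "PSym = {S. transpose S = S \<and> (\<forall>x. x \<noteq> 0 \<longrightarrow> x \<bullet> (S *v x) > 0)}"

text \<open>
  The operations \<open>*\<close> and \<open>^\<close> on the type of vectors are componentwise, so matrix powers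
  are iterated matrix products.
\<close>

definition mat_exp :: "real^'n^'n \<Rightarrow> real^'n^'n" where
  "mat_exp A = (\<Sum>k. (1 / fact k) *\<^sub>R (((**) A ^^ k) (mat 1)))"

definition psd_sqrt :: "real^'n^'n \<Rightarrow> real^'n^'n" where
  "psd_sqrt A = (THE S. S \<in> PSym \<and> S ** S = A)"

text \<open>
  On the positive definite matrices the principal logarithm is the unique symmetric inverse image
  under the matrix exponential.
\<close>

definition mat_log :: "real^'n^'n \<Rightarrow> real^'n^'n" where
  "mat_log S = (THE L. transpose L = L \<and> mat_exp L = S)"

definition right_stretch :: "real^'n^'n \<Rightarrow> real^'n^'n" where
  "right_stretch F = psd_sqrt (transpose F ** F)"

definition dev :: "real^'n^'n \<Rightarrow> real^'n^'n" where
  "dev X = X - (trace X / real CARD('n)) *\<^sub>R mat 1"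

definition outer_product :: "real^'n \<Rightarrow> real^'n \<Rightarrow> real^'n^'n" where
  "outer_product \<xi> \<eta> = (\<chi> i j. \<xi> $ i * \<eta> $ j)"

text \<open>The library norm on matrices is the Frobenius norm.\<close>

lemma power2_norm_eq_trace:
  fixes X :: "real^'n^'n"
  shows "(norm X)\<^sup>2 = trace (transpose X ** X)"
proof -
  have "(norm X)\<^sup>2 = (\<Sum>i\<in>UNIV. \<Sum>j\<in>UNIV. X $ i $ j * X $ i $ j)"
    unfolding power2_norm_eq_inner inner_vec_def by simp
  also have "\<dots> = (\<Sum>j\<in>UNIV. \<Sum>i\<in>UNIV. X $ i $ j * X $ i $ j)"
    by (rule sum.swap)
  also have "\<dots> = trace (transpose X ** X)"
    by (simp add: trace_def matrix_matrix_mult_def transpose_def)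
  finally show ?thesis .
qed

text \<open>
  \<open>Deriv f x\<close> is the Frechet derivative of \<open>f\<close> at \<open>x\<close> as a bounded linear map; it is meaningful
  only where \<open>f\<close> is differentiable. The second derivative is the derivative of the map
  \<open>Deriv f\<close>, so that \<open>Deriv (Deriv f) x h k\<close> is $D^2 f(x).(h,k)$.
\<close>

definition Deriv ::
  "('a::real_normed_vector \<Rightarrow> 'b::real_normed_vector) \<Rightarrow> 'a \<Rightarrow> ('a \<Rightarrow>\<^sub>L 'b)" where
  "Deriv f x = Blinfun (frechet_derivative f (at x))"

definition C2_on ::
  "('a::real_normed_vector \<Rightarrow> 'b::real_normed_vector) \<Rightarrow> 'a set \<Rightarrow> bool" where
  "C2_on f S \<longleftrightarrow>
     (\<forall>x\<in>S. f differentiable (at x)) \<and>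
     (\<forall>x\<in>S. Deriv f differentiable (at x)) \<and>
     continuous_on S (Deriv (Deriv f))"

text \<open>
  Energies are total functions on matrices, but only their values on the open set \<open>GL_plus\<close>
  matter. Ellipticity is a notion for \<open>C\<^sup>2\<close> energies, hence the first conjunct.
\<close>

definition legendre_hadamard_elliptic_at ::
  "(real^'n^'n \<Rightarrow> real) \<Rightarrow> real^'n^'n \<Rightarrow> bool" where
  "legendre_hadamard_elliptic_at W F \<longleftrightarrow>
     C2_on W GL_plus \<and> F \<in> GL_plus \<and>
     (\<forall>\<xi> \<eta>. Deriv (Deriv W) F (outer_product \<xi> \<eta>) (outer_product \<xi> \<eta>) \<ge> 0)"

definition ellipticity_domain ::
  "(real^'n^'n \<Rightarrow> real) \<Rightarrow> (real^'n^'n) set \<Rightarrow> bool" where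
  "ellipticity_domain W E \<longleftrightarrow>
     E \<subseteq> GL_plus \<and> (\<forall>F\<in>E. legendre_hadamard_elliptic_at W F)"

definition maximal_ellipticity_domain ::
  "(real^'n^'n \<Rightarrow> real) \<Rightarrow> (real^'n^'n) set" where
  "maximal_ellipticity_domain W = {F \<in> GL_plus. legendre_hadamard_elliptic_at W F}"

definition described_by :: "(real^'n^'n) set \<Rightarrow> (real^'n^'n) set" where
  "described_by E = {F \<in> GL_plus. right_stretch F \<in> E}"

end

theory Submission
  imports Defs
begin

text \<open>
  With \<open>C = F\<^sup>T F\<close> the energy is \<open>\<parallel>dev log C\<parallel>\<^sup>2 / 4\<close>. The compact integral
  \<open>log C = \<integral>\<^sub>0\<^sup>1 (C - 1) (1 + s (C - 1))\<^sup>-\<^sup>1 ds\<close> makes the logarithm continuously differentiable without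
  any case distinction on coinciding eigenvalues. Since the logarithm commutes with \<open>C\<close>, the gradient of the
  energy is \<open>F\<^sup>-\<^sup>T dev log C\<close>, so one derivative of the logarithm suffices for the Hessian of the energy.

  On \<open>\<xi> \<otimes> \<eta>\<close>, in an eigenbasis of \<open>C\<close>, the Hessian depends on the coordinates \<open>a\<^sub>i\<close> of
  \<open>F\<^sup>-\<^sup>1 \<xi>\<close> and \<open>b\<^sub>i\<close> of \<open>\<eta>\<close>. By the arithmetic-geometric mean inequality and
  \<open>ln t \<ge> 2 (t - 1) / (t + 1)\<close> it is bounded below by a form in the products \<open>p\<^sub>i = a\<^sub>i b\<^sub>i\<close> alone. If all
  \<open>p\<^sub>i\<close> have the same sign, nonnegativity of this form amounts to \<open>z\<^sub>i \<le> 2/3\<close> for the eigenvalues \<open>z\<^sub>i\<close> of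
  \<open>dev log U\<close>, and this is what \<open>\<Sum>z\<^sub>i = 0\<close>, \<open>\<Sum>z\<^sub>i\<^sup>2 \<le> 2/3\<close> give. If the signs are mixed, the lower bound is
  a convex combination of forms in two variables, which are nonnegative by a discriminant estimate.
\<close>

section \<open>Matrix calculus and matrices in spectral form\<close>

lemma bounded_bilinear_matrix_mult:
  "bounded_bilinear ((**) :: real^'n^'m \<Rightarrow> real^'k^'n \<Rightarrow> real^'k^'m)"
  unfolding bilinear_conv_bounded_bilinear[symmetric] bilinear_def
  by (auto intro!: linearI simp: vec_eq_iff matrix_matrix_mult_def sum.distrib sum_distrib_left
      algebra_simps)

interpretation matrix_mult: bounded_bilinear "(**) :: real^'n^'m \<Rightarrow> real^'k^'n \<Rightarrow> real^'k^'m"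
  by (rule bounded_bilinear_matrix_mult)

lemma linear_trace: "linear (trace :: real^'n^'n \<Rightarrow> real)"
  by (auto intro!: linearI simp: trace_def sum.distrib sum_distrib_left)

lemma linear_transpose: "linear (transpose :: real^'n^'m \<Rightarrow> real^'m^'n)"
  by (auto intro!: linearI simp: transpose_def vec_eq_iff)

lemma linear_dev: "linear (dev :: real^'n^'n \<Rightarrow> real^'n^'n)"
  unfolding dev_def
  by (auto intro!: linearI simp: linear_add[OF linear_trace] linear_scale[OF linear_trace]
      scaleR_add_left add_divide_distrib algebra_simps)

lemma inner_matrix: "(A :: real^'n^'m) \<bullet> B = (\<Sum>i\<in>UNIV. \<Sum>j\<in>UNIV. A $ i $ j * B $ i $ j)"
  by (simp add: inner_vec_def)

lemma inner_matrix_mult_left: "((A :: real^'n^'m) ** B) \<bullet> C = B \<bullet> (transpose A ** C)"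
proof -
  have "(A ** B) \<bullet> C = (\<Sum>i\<in>UNIV. \<Sum>j\<in>UNIV. \<Sum>k\<in>UNIV. A $ i $ k * B $ k $ j * C $ i $ j)"
    by (simp add: inner_matrix matrix_matrix_mult_def sum_distrib_right)
  also have "\<dots> = (\<Sum>i\<in>UNIV. \<Sum>k\<in>UNIV. \<Sum>j\<in>UNIV. A $ i $ k * B $ k $ j * C $ i $ j)"
    by (intro sum.cong refl sum.swap)
  also have "\<dots> = (\<Sum>k\<in>UNIV. \<Sum>i\<in>UNIV. \<Sum>j\<in>UNIV. A $ i $ k * B $ k $ j * C $ i $ j)"
    by (rule sum.swap)
  also have "\<dots> = (\<Sum>k\<in>UNIV. \<Sum>j\<in>UNIV. \<Sum>i\<in>UNIV. A $ i $ k * B $ k $ j * C $ i $ j)"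
    by (intro sum.cong refl sum.swap)
  also have "\<dots> = B \<bullet> (transpose A ** C)"
    by (simp add: inner_matrix matrix_matrix_mult_def transpose_def sum_distrib_left mult_ac)
  finally show ?thesis .
qed

lemma inner_transpose: "transpose (A :: real^'n^'m) \<bullet> transpose B = A \<bullet> B"
  unfolding inner_matrix transpose_def by simp (rule sum.swap)

lemma inner_matrix_mult_right: "((A :: real^'n^'m) ** B) \<bullet> C = A \<bullet> (C ** transpose B)"
  using inner_matrix_mult_left[of "transpose B" "transpose A" "transpose C"]
  by (simp add: inner_transpose transpose_transpose flip: matrix_transpose_mul)
    (metis inner_transpose matrix_transpose_mul transpose_transpose)

lemma matrix_inv_eqI:
  fixes A B :: "real^'n^'n"
  assumes "A ** B = mat 1"
  shows "matrix_inv A = B"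
proof -
  have "invertible A" using assms invertible_right_inverse by blast
  then have "matrix_inv A ** A = mat 1"
    unfolding invertible_def matrix_inv_def by (rule someI_ex[THEN conjunct2])
  then show ?thesis by (metis assms matrix_mul_assoc matrix_mul_lid matrix_mul_rid)
qed

lemma inner_outer_product: "M \<bullet> outer_product a b = a \<bullet> (M *v b)"
  by (simp add: inner_matrix outer_product_def inner_vec_def matrix_vector_mult_def
      sum_distrib_left mult_ac)

lemma matrix_mult_outer_product: "A ** outer_product a b = outer_product (A *v a) b"
  by (simp add: outer_product_def vec_eq_iff matrix_matrix_mult_def matrix_vector_mult_def
      sum_distrib_right mult.assoc)

lemma outer_product_matrix_mult: "outer_product a b ** A = outer_product a (transpose A *v b)"
  by (simp add: outer_product_def vec_eq_iff matrix_matrix_mult_def matrix_vector_mult_def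
      sum_distrib_left transpose_def mult_ac)

lemma transpose_outer_product: "transpose (outer_product a b) = outer_product b a"
  by (simp add: outer_product_def vec_eq_iff transpose_def)

lemma outer_product_vector_mult: "outer_product a b *v c = (b \<bullet> c) *\<^sub>R a"
  by (simp add: outer_product_def vec_eq_iff matrix_vector_mult_def inner_vec_def
      sum_distrib_left mult_ac)

lemma inner_mat_1: "(mat 1 :: real^'n^'n) \<bullet> A = trace A"
proof -
  have "(mat 1 :: real^'n^'n) \<bullet> A = (\<Sum>i\<in>UNIV. \<Sum>j\<in>UNIV. if i = j then A $ i $ j else 0)"
    unfolding inner_matrix mat_def by (intro sum.cong refl) auto
  then show ?thesis by (simp add: trace_def)
qed

lemma trace_mat_1: "trace (mat 1 :: real^'n^'n) = real CARD('n)"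
  by (simp add: trace_def mat_def)

lemma trace_dev: "trace (dev (A :: real^'n^'n)) = 0"
  by (simp add: dev_def linear_diff[OF linear_trace] linear_scale[OF linear_trace] trace_mat_1)

lemma inner_dev_dev: "dev (A :: real^'n^'n) \<bullet> dev B = dev A \<bullet> B"
proof -
  have "dev A \<bullet> dev B = dev A \<bullet> B - (trace B / real CARD('n)) * (dev A \<bullet> mat 1)"
    by (simp add: dev_def[of B] inner_diff_right)
  then show ?thesis using trace_dev[of A] inner_mat_1[of "dev A"] by (simp add: inner_commute)
qed

lemma inner_transpose_vector_mult: "(x :: real^'m) \<bullet> (A *v y) = (transpose A *v x) \<bullet> y"
  by (metis dot_lmul_matrix inner_commute matrix_vector_mul_assoc transpose_matrix_vector vector_transpose_matrix)

text \<open>Functional calculus in a fixed basis: the eigenvalues form a function on the index type,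
  unordered and with repetitions, so that functions of the matrix act pointwise on \<open>d\<close>.
  Orthogonality of \<open>Q\<close> is a separate hypothesis.\<close>

definition spectral :: "real^'n^'n \<Rightarrow> ('n \<Rightarrow> real) \<Rightarrow> real^'n^'n" where
  "spectral Q d = Q ** (\<chi> i j. if i = j then d i else 0) ** transpose Q"

lemma spectral_component: "spectral Q d $ i $ j = (\<Sum>k\<in>UNIV. d k * (Q $ i $ k * Q $ j $ k))"
  unfolding spectral_def matrix_matrix_mult_def transpose_def
  by (simp add: if_distrib [of "\<lambda>x. _ * x"] cong: if_cong) (simp add: mult_ac)

text \<open>A finite sum with scalar coefficients: series and integrals of matrices sharing the
  basis \<open>Q\<close> reduce to scalar ones.\<close>

lemma spectral_eq_sum:
  "spectral Q d = (\<Sum>k\<in>UNIV. d k *\<^sub>R outer_product (column k Q) (column k Q))"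
  by (simp add: vec_eq_iff spectral_component outer_product_def column_def)

lemma transpose_spectral: "transpose (spectral Q d) = spectral Q d"
  by (simp add: vec_eq_iff spectral_component transpose_def mult_ac)

lemma sum_matrix_vector_mult: "(\<Sum>k\<in>K. A k) *v x = (\<Sum>k\<in>K. A k *v (x :: real^'n))"
  by (induction K rule: infinite_finite_induct) (simp_all add: matrix_vector_mult_add_rdistrib)

lemma inner_spectral_vector_mult:
  "x \<bullet> (spectral Q d *v y) = (\<Sum>k\<in>UNIV. d k * ((transpose Q *v x) $ k * (transpose Q *v y) $ k))"
proof -
  have "x \<bullet> (spectral Q d *v y) = (\<Sum>k\<in>UNIV. d k * ((x \<bullet> column k Q) * (column k Q \<bullet> y)))"
    unfolding spectral_eq_sum
    by (simp add: inner_sum_right sum_matrix_vector_mult outer_product_vector_mult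
      scaleR_matrix_vector_assoc[symmetric] mult_ac)
  moreover have "(transpose Q *v z) $ k = column k Q \<bullet> z" for z k
    by (simp add: matrix_vector_mult_def transpose_def column_def inner_vec_def)
  ultimately show ?thesis by (simp add: inner_commute mult_ac)
qed

lemma spectral_add: "spectral Q d + spectral Q e = spectral Q (\<lambda>k. d k + e k)"
  by (simp add: vec_eq_iff spectral_component sum.distrib algebra_simps)

lemma spectral_diff: "spectral Q d - spectral Q e = spectral Q (\<lambda>k. d k - e k)"
  by (simp add: vec_eq_iff spectral_component sum_subtractf algebra_simps)

lemma spectral_scaleR: "r *\<^sub>R spectral Q d = spectral Q (\<lambda>k. r * d k)"
  by (simp add: vec_eq_iff spectral_component sum_distrib_left algebra_simps)

context
  fixes Q :: "real^'n^'n"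
  assumes Q: "orthogonal_matrix Q"
begin

lemma spectral_mult: "spectral Q d ** spectral Q e = spectral Q (\<lambda>k. d k * e k)"
proof -
  let ?D = "\<lambda>d. (\<chi> i j. if i = j then d i else 0) :: real^'n^'n"
  have "?D d ** ?D e = ?D (\<lambda>k. d k * e k)"
    by (simp add: vec_eq_iff matrix_matrix_mult_def if_distrib [of "\<lambda>x. x * _"] cong: if_cong)
  moreover have "spectral Q d ** spectral Q e = Q ** ?D d ** (transpose Q ** Q) ** ?D e ** transpose Q"
    unfolding spectral_def by (simp add: matrix_mul_assoc)
  ultimately show ?thesis
    using Q by (simp add: orthogonal_matrix_def spectral_def flip: matrix_mul_assoc)
      (simp add: matrix_mul_assoc)
qed

lemma spectral_1: "spectral Q (\<lambda>_. 1) = mat 1"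
proof -
  have "(\<chi> i j. if i = j then 1 else 0) = (mat 1 :: real^'n^'n)" by (simp add: mat_def)
  then show ?thesis using Q by (simp add: spectral_def orthogonal_matrix_def)
qed

lemma trace_spectral: "trace (spectral Q d) = (\<Sum>k\<in>UNIV. d k)"
proof -
  have "trace (spectral Q d) = trace (transpose Q ** (Q ** (\<chi> i j. if i = j then d i else 0)))"
    unfolding spectral_def by (rule trace_mul_sym)
  then show ?thesis using Q by (simp add: matrix_mul_assoc orthogonal_matrix_def trace_def)
qed

lemma norm_spectral: "(norm (spectral Q d))\<^sup>2 = (\<Sum>k\<in>UNIV. (d k)\<^sup>2)"
    by (subst power2_norm_eq_trace) (simp add: transpose_spectral spectral_mult trace_spectral power2_eq_square)

lemma dev_spectral: "dev (spectral Q d) = spectral Q (\<lambda>k. d k - (\<Sum>k\<in>UNIV. d k) / real CARD('n))"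
proof -
  have "dev (spectral Q d) = spectral Q d - ((\<Sum>k\<in>UNIV. d k) / real CARD('n)) *\<^sub>R spectral Q (\<lambda>_. 1)"
    by (simp add: dev_def trace_spectral spectral_1)
  then show ?thesis by (simp only: spectral_scaleR spectral_diff) simp
qed

lemma matrix_inv_spectral:
  assumes "\<And>k. d k \<noteq> 0"
  shows "matrix_inv (spectral Q d) = spectral Q (\<lambda>k. 1 / d k)"
  using assms by (intro matrix_inv_eqI) (simp add: spectral_mult spectral_1)

lemma spectral_power: "(((**) (spectral Q d) ^^ k) (mat 1)) = spectral Q (\<lambda>i. d i ^ k)"
  by (induction k) (simp_all add: spectral_1 spectral_mult)

lemma mat_exp_spectral: "mat_exp (spectral Q d) = spectral Q (\<lambda>k. exp (d k))"
proof -
  have "(\<lambda>k. (1 / fact k) *\<^sub>R spectral Q (\<lambda>i. d i ^ k)) sums spectral Q (\<lambda>k. exp (d k))"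
    unfolding spectral_scaleR unfolding spectral_eq_sum
    using exp_converges[where 'a=real]
    by (intro sums_sum bounded_linear.sums[OF bounded_linear_scaleR_left])
      (simp add: field_simps)
  then show ?thesis unfolding mat_exp_def spectral_power by (rule sums_unique[symmetric])
qed

lemma spectral_pos_def:
  assumes "\<And>k. d k > 0"
  shows "spectral Q d \<in> PSym"
proof -
  have "x \<bullet> (spectral Q d *v x) > 0" if "x \<noteq> 0" for x
  proof -
    let ?y = "transpose Q *v x"
    have "Q *v ?y = x"
      using Q by (simp add: matrix_vector_mul_assoc orthogonal_matrix_def del: transpose_matrix_vector)
    then have "?y \<noteq> 0" using that by auto
    then obtain k where "?y $ k \<noteq> 0" by (auto simp: vec_eq_iff)
    then show ?thesis unfolding inner_spectral_vector_mult
      using assms by (intro sum_pos2[of _ k]) (auto simp: less_imp_le zero_less_mult_iff linorder_neq_iff)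
  qed
  then show ?thesis by (simp add: PSym_def transpose_spectral)
qed

lemma spectral_pos_defD:
  assumes "\<And>x. x \<noteq> 0 \<Longrightarrow> x \<bullet> (spectral Q d *v x) > 0"
  shows "d k > 0"
proof -
  \<comment> \<open>The vector \<open>Q *v axis k 1\<close> is an eigenvector for
    \<open>d k\<close>; testing with it isolates this eigenvalue.\<close>
  have 1: "transpose Q *v (Q *v axis k 1) = axis k 1"
    using Q by (simp add: matrix_vector_mul_assoc orthogonal_matrix)
  have "Q *v axis k 1 \<noteq> 0"
  proof
    assume "Q *v axis k 1 = 0"
    with 1 show False by (simp add: axis_eq_0_iff del: transpose_matrix_vector)
  qed
  from assms[OF this] show ?thesis
    unfolding inner_spectral_vector_mult 1
    by (simp add: axis_def if_distrib [of "\<lambda>x. _ * x"] cong: if_cong)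
qed

end

text \<open>With \<open>M = R\<^sup>T Q\<close>, the hypothesis says that \<open>M\<^sub>i\<^sub>j (f (d\<^sub>j) - f (e\<^sub>i)) = 0\<close>.\<close>

lemma spectral_inj:
  assumes Q: "orthogonal_matrix Q" and R: "orthogonal_matrix R"
    and eq: "spectral Q (\<lambda>k. f (d k)) = spectral R (\<lambda>k. f (e k))"
    and inj: "inj_on f (range d \<union> range e)"
  shows "spectral Q d = spectral R e"
proof -
  let ?D = "\<lambda>d. (\<chi> i j. if i = j then d i else 0) :: real^'n^'n"
  define M where "M = transpose R ** Q"
  have MR: "R ** M = Q" and MQ: "M ** transpose Q = transpose R"
    using Q R by (auto simp: M_def orthogonal_matrix_def matrix_mul_assoc)
      (simp add: flip: matrix_mul_assoc)
  have MD: "(M ** ?D d) $ i $ j = M $ i $ j * d j" "(?D d ** M) $ i $ j = d i * M $ i $ j" for d i j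
    by (simp_all add: matrix_matrix_mult_def if_distrib [of "\<lambda>x. x * _"] if_distrib [of "\<lambda>x. _ * x"] cong: if_cong)
  have "M ** ?D (f \<circ> d) = transpose R ** spectral Q (f \<circ> d) ** Q"
    unfolding M_def spectral_def using Q
    by (simp add: orthogonal_matrix_def flip: matrix_mul_assoc)
  also have "\<dots> = transpose R ** spectral R (f \<circ> e) ** Q" using eq by (simp add: comp_def)
  also have "\<dots> = ?D (f \<circ> e) ** M"
    unfolding M_def spectral_def using R
    by (simp add: orthogonal_matrix_def matrix_mul_assoc)
  finally have E: "M ** ?D (f \<circ> d) = ?D (f \<circ> e) ** M" .
  have "M $ i $ j * f (d j) = f (e i) * M $ i $ j" for i j
    using arg_cong[OF E, of "\<lambda>A. A $ i $ j"] unfolding MD comp_def .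
  then have "M $ i $ j = 0 \<or> f (d j) = f (e i)" for i j
    by (simp add: mult.commute[of "f _"])
  then have *: "M $ i $ j = 0 \<or> d j = e i" for i j
    using inj_onD[OF inj, of "d j" "e i"] by blast
  then have "M ** ?D d = ?D e ** M"
    unfolding vec_eq_iff MD using * by fastforce
  then have "R ** (M ** ?D d) ** transpose Q = R ** (?D e ** M) ** transpose Q" by simp
  moreover have "R ** (M ** ?D d) ** transpose Q = spectral Q d"
    unfolding spectral_def matrix_mul_assoc MR ..
  moreover have "R ** (?D e ** M) ** transpose Q = spectral R e"
    unfolding spectral_def by (simp add: MQ flip: matrix_mul_assoc)
  ultimately show ?thesis by simp
qed

section \<open>The spectral theorem, square root and logarithm\<close>

lemma symmetric_matrix_eigenvector:
  fixes A :: "real^'n^'n"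
  assumes A: "transpose A = A" and S: "subspace S" and inv: "\<And>x. x \<in> S \<Longrightarrow> A *v x \<in> S"
    and w: "w \<in> S" "w \<noteq> 0"
  obtains v m where "v \<in> S" "norm v = 1" "A *v v = m *\<^sub>R v"
proof -
  let ?K = "S \<inter> sphere 0 1"
  have "compact ?K" using closed_subspace[OF S] by (simp add: closed_Int_compact)
  moreover have "w /\<^sub>R norm w \<in> ?K" using w S by (simp add: subspace_scale)
  moreover have "continuous_on ?K (\<lambda>x. x \<bullet> (A *v x))"
    by (intro continuous_intros matrix_vector_mult_linear_continuous_on)
  ultimately obtain v where v: "v \<in> ?K" and max: "\<And>x. x \<in> ?K \<Longrightarrow> x \<bullet> (A *v x) \<le> v \<bullet> (A *v v)"
    using continuous_attains_sup[of ?K "\<lambda>x. x \<bullet> (A *v x)"] by blast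
  define m where "m = v \<bullet> (A *v v)"
  have v1: "v \<bullet> v = 1" "v \<in> S" using v by (auto simp: dot_square_norm)
  have bound: "x \<bullet> (A *v x) \<le> m * (x \<bullet> x)" if "x \<in> S" for x
  proof (cases "x = 0")
    case False
    then have "x /\<^sub>R norm x \<in> ?K" using that S by (simp add: subspace_scale)
    from max[OF this] have "(x \<bullet> (A *v x)) / (norm x)\<^sup>2 \<le> m"
      by (simp add: m_def matrix_vector_mult_scaleR power2_eq_square divide_simps)
    then show ?thesis using False by (simp add: divide_le_eq dot_square_norm)
  qed simp
  \<comment> \<open>The negative residual of the eigenvalue equation. Unless it vanishes, a small
    step from \<open>v\<close> along \<open>- u\<close> raises the Rayleigh quotient above
    \<open>m\<close>.\<close>
  define u where "u = m *\<^sub>R v - A *v v"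
  have u: "u \<in> S" unfolding u_def using v1 S inv by (simp add: subspace_diff subspace_scale)
  define b where "b = m * (u \<bullet> u) - u \<bullet> (A *v u)"
  have sym: "v \<bullet> (A *v u) = u \<bullet> (A *v v)"
    using inner_transpose_vector_mult[of v A u] A by (simp add: inner_commute)
  have uAv: "u \<bullet> (A *v v) = m * (u \<bullet> v) - u \<bullet> u"
    by (subst (3) u_def) (simp add: inner_diff_right)
  have quad: "0 \<le> 2 * t * (u \<bullet> u) + t\<^sup>2 * b" for t
  proof -
    have "v + t *\<^sub>R u \<in> S" using v1 u S by (simp add: subspace_add subspace_scale)
    from bound[OF this] have "m + 2 * t * (u \<bullet> (A *v v)) + t\<^sup>2 * (u \<bullet> (A *v u))
        \<le> m * (1 + 2 * t * (u \<bullet> v) + t\<^sup>2 * (u \<bullet> u))"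
      by (simp add: inner_add_left inner_add_right matrix_vector_right_distrib
          matrix_vector_mult_scaleR sym v1 inner_commute[of v u] power2_eq_square algebra_simps
          flip: m_def)
    then show ?thesis unfolding uAv b_def by (simp add: algebra_simps)
  qed
  have "u \<bullet> u \<le> 0"
  proof (rule ccontr)
    assume "\<not> u \<bullet> u \<le> 0"
    then have p: "u \<bullet> u > 0" by linarith
    \<comment> \<open>The step is short enough that the second-order term \<open>t * b\<close>
      cannot outweigh \<open>2 * (u \<bullet> u)\<close>; the summand 1 covers
      \<open>b = 0\<close>.\<close>
    define t where "t = - (u \<bullet> u) / (\<bar>b\<bar> + 1)"
    have "t < 0" using p by (simp add: t_def divide_neg_pos)
    with quad[of t] have "2 * (u \<bullet> u) + t * b \<le> 0"
      using zero_le_mult_iff[of t "2 * (u \<bullet> u) + t * b"] by (auto simp: power2_eq_square algebra_simps)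
    moreover have "\<bar>t * b\<bar> \<le> u \<bullet> u"
      unfolding t_def using p by (simp add: abs_mult divide_le_eq mult_left_mono)
    ultimately show False using p by linarith
  qed
  then have "u = 0" using inner_gt_zero_iff[of u] by linarith
  then have "A *v v = m *\<^sub>R v" by (simp add: u_def)
  then show ?thesis using that v1 v by auto
qed

text \<open>Induction on the number of eigenvectors: by symmetry the orthogonal complement of those
  found is invariant, and it is nontrivial as long as fewer than \<open>CARD('n)\<close> are
  found.\<close>

lemma symmetric_matrix_orthonormal_eigenvectors:
  fixes A :: "real^'n^'n"
  assumes A: "transpose A = A" and "k \<le> CARD('n)"
  shows "\<exists>B. finite B \<and> card B = k \<and> pairwise orthogonal B \<and>
    (\<forall>v\<in>B. norm v = 1 \<and> (\<exists>m. A *v v = m *\<^sub>R v))"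
  using assms(2)
proof (induction k)
  case 0
  then show ?case by (intro exI[of _ "{}"]) auto
next
  case (Suc k)
  then obtain B where B: "finite B" "card B = k" "pairwise orthogonal B"
      "\<And>v. v \<in> B \<Longrightarrow> norm v = 1" "\<And>v. v \<in> B \<Longrightarrow> \<exists>m. A *v v = m *\<^sub>R v" by auto
  have "dim B < DIM(real^'n)" using dim_le_card'[OF B(1)] B(2) Suc.prems by simp
  then obtain w where w: "w \<noteq> 0" "\<And>y. y \<in> span B \<Longrightarrow> orthogonal w y"
    using orthogonal_to_subspace_exists by blast
  let ?S = "{x. \<forall>b\<in>B. orthogonal b x}"
  have "subspace ?S" by (auto simp: subspace_def orthogonal_def inner_add_right)
  moreover have "A *v x \<in> ?S" if x: "x \<in> ?S" for x
  proof -
    have "b \<bullet> (A *v x) = 0" if b: "b \<in> B" for b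
    proof -
      obtain m where "A *v b = m *\<^sub>R b" using B(5) b by blast
      then show ?thesis using x b inner_transpose_vector_mult[of b A x] A
        by (auto simp: orthogonal_def)
    qed
    then show ?thesis by (simp add: orthogonal_def)
  qed
  moreover have "w \<in> ?S" using w(2) by (auto simp: span_base orthogonal_commute)
  ultimately obtain v m where v: "v \<in> ?S" "norm v = 1" "A *v v = m *\<^sub>R v"
    using w(1) symmetric_matrix_eigenvector[OF A, of ?S w] by blast
  have "v \<notin> B" using v(1,2) by (auto simp: orthogonal_def dot_square_norm)
  then show ?case
    using B v by (intro exI[of _ "insert v B"])
      (auto simp: pairwise_insert orthogonal_commute)
qed

theorem symmetric_matrix_spectral:
  fixes A :: "real^'n^'n"
  assumes A: "transpose A = A"
  obtains Q d where "orthogonal_matrix Q" "A = spectral Q d"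
proof -
  obtain B where B: "finite B" "card B = CARD('n)" "pairwise orthogonal B"
      "\<And>v. v \<in> B \<Longrightarrow> norm v = 1" "\<And>v. v \<in> B \<Longrightarrow> \<exists>m. A *v v = m *\<^sub>R v"
    using symmetric_matrix_orthonormal_eigenvectors[OF A order_refl] by auto
  then obtain f :: "'n \<Rightarrow> real^'n" where f: "bij_betw f UNIV B"
    using finite_same_card_bij[of "UNIV :: 'n set" B] by auto
  then have fB: "f j \<in> B" for j by (auto simp: bij_betw_def)
  then have "\<forall>j. \<exists>m. A *v f j = m *\<^sub>R f j" using B(5) by blast
  from choice[OF this] obtain d where d: "\<And>j. A *v f j = d j *\<^sub>R f j" by blast
  define Q :: "real^'n^'n" where "Q = (\<chi> i j. f j $ i)"
  have ff: "f i \<bullet> f j = (if i = j then 1 else 0)" for i j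
    using fB[of i] fB[of j] B(3,4) f
    by (auto simp: dot_square_norm pairwise_def orthogonal_def bij_betw_def inj_eq)
  have "(transpose Q ** Q) $ i $ j = f i \<bullet> f j" for i j
    by (simp add: Q_def matrix_matrix_mult_def transpose_def inner_vec_def)
  then have "transpose Q ** Q = mat 1" by (simp add: vec_eq_iff mat_def ff)
  then have Q: "orthogonal_matrix Q" by (simp add: orthogonal_matrix)
  have "(A ** Q) $ i $ j = (A *v f j) $ i" for i j
    by (simp add: Q_def matrix_matrix_mult_def matrix_vector_mult_def)
  moreover have "(Q ** (\<chi> i j. if i = j then d i else 0)) $ i $ j = (d j *\<^sub>R f j) $ i" for i j
    by (simp add: Q_def matrix_matrix_mult_def if_distrib [of "\<lambda>x. _ * x"] cong: if_cong)
  ultimately have "A ** Q = Q ** (\<chi> i j. if i = j then d i else 0)" by (simp add: vec_eq_iff d)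
  then have "spectral Q d = A ** (Q ** transpose Q)" by (simp add: spectral_def matrix_mul_assoc)
  then show ?thesis using that[OF Q, of d] Q by (simp add: orthogonal_matrix_def)
qed

text \<open>The definite description needs uniqueness: a competing root is again spectral with
  positive eigenvalues, and squaring is injective on nonnegative numbers, so
  \<open>spectral_inj\<close> applies.\<close>

lemma psd_sqrt_spectral:
  assumes Q: "orthogonal_matrix Q" and d: "\<And>k. d k > 0"
  shows "psd_sqrt (spectral Q d) = spectral Q (\<lambda>k. sqrt (d k))"
  unfolding psd_sqrt_def
proof (rule the_equality)
  show "spectral Q (\<lambda>k. sqrt (d k)) \<in> PSym \<and>
      spectral Q (\<lambda>k. sqrt (d k)) ** spectral Q (\<lambda>k. sqrt (d k)) = spectral Q d"
    using d by (auto simp: spectral_mult[OF Q] less_imp_le intro!: spectral_pos_def[OF Q])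
next
  fix S assume S: "S \<in> PSym \<and> S ** S = spectral Q d"
  then obtain R e where R: "orthogonal_matrix R" "S = spectral R e"
    unfolding PSym_def using symmetric_matrix_spectral[of S] by blast
  have e: "e k > 0" for k
    using S spectral_pos_defD[OF R(1), of e] unfolding R(2) PSym_def by blast
  have "spectral R (\<lambda>k. (e k)\<^sup>2) = spectral Q (\<lambda>k. (sqrt (d k))\<^sup>2)"
    using S d by (simp add: R(2) spectral_mult[OF R(1)] less_imp_le power2_eq_square)
  moreover have "x \<ge> 0" if "x \<in> range e \<union> range (\<lambda>k. sqrt (d k))" for x
    using e d that by (auto simp: less_imp_le)
  then have "inj_on power2 (range e \<union> range (\<lambda>k. sqrt (d k)))"
    by - (rule inj_onI, simp only: power2_eq_imp_eq)
  ultimately show "S = spectral Q (\<lambda>k. sqrt (d k))"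
    unfolding R(2) by (rule spectral_inj[OF R(1) Q])
qed

text \<open>As for the square root, with \<open>exp\<close>, which is injective on all of the
  reals.\<close>

lemma mat_log_spectral:
  assumes Q: "orthogonal_matrix Q" and d: "\<And>k. d k > 0"
  shows "mat_log (spectral Q d) = spectral Q (\<lambda>k. ln (d k))"
  unfolding mat_log_def
proof (rule the_equality)
  show "transpose (spectral Q (\<lambda>k. ln (d k))) = spectral Q (\<lambda>k. ln (d k)) \<and>
      mat_exp (spectral Q (\<lambda>k. ln (d k))) = spectral Q d"
    using d by (simp add: transpose_spectral mat_exp_spectral[OF Q])
next
  fix L assume L: "transpose L = L \<and> mat_exp L = spectral Q d"
  then obtain R e where R: "orthogonal_matrix R" "L = spectral R e"
    using symmetric_matrix_spectral[of L] by blast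
  have "spectral R (\<lambda>k. exp (e k)) = spectral Q (\<lambda>k. exp (ln (d k)))"
    using L d by (simp add: R(2) mat_exp_spectral[OF R(1)])
  then show "L = spectral Q (\<lambda>k. ln (d k))"
    unfolding R(2) by (rule spectral_inj[OF R(1) Q]) (auto simp: inj_on_def)
qed

section \<open>The tensor \<open>F^T F\<close> and the logarithm of the stretch in its
  eigenbasis\<close>

lemma spectral_transpose_mult_self:
  fixes F :: "real^'n^'n"
  assumes F: "det F \<noteq> 0"
  obtains Q c where "orthogonal_matrix Q" "\<And>k. c k > 0" "transpose F ** F = spectral Q c"
proof -
  have "transpose (transpose F ** F) = transpose F ** F"
    by (simp add: matrix_transpose_mul transpose_transpose)
  then obtain Q c where Q: "orthogonal_matrix Q" "transpose F ** F = spectral Q c"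
    using symmetric_matrix_spectral by blast
  have "x \<bullet> (spectral Q c *v x) > 0" if x: "x \<noteq> 0" for x
  proof -
    have "F *v x \<noteq> 0"
      using F x matrix_left_invertible_ker[of F] by (auto simp: invertible_left_inverse simp flip: invertible_det_nz)
    moreover have "x \<bullet> (spectral Q c *v x) = (F *v x) \<bullet> (F *v x)"
      unfolding Q(2)[symmetric] by (simp add: inner_transpose_vector_mult transpose_transpose
        flip: matrix_vector_mul_assoc del: transpose_matrix_vector)
    ultimately show ?thesis by simp
  qed
  then have "c k > 0" for k by (rule spectral_pos_defD[OF Q(1)])
  then show ?thesis using that Q by blast
qed

lemma mat_log_right_stretch:
  fixes F :: "real^'n^'n"
  assumes Q: "orthogonal_matrix Q" and c: "\<And>k. c k > 0" and F: "transpose F ** F = spectral Q c"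
  shows "mat_log (right_stretch F) = spectral Q (\<lambda>k. ln (c k) / 2)"
proof -
  have "(\<lambda>k. ln (sqrt (c k))) = (\<lambda>k. ln (c k) / 2)"
    by (intro ext ln_sqrt less_imp_le c)
  then show ?thesis
    using c by (simp add: right_stretch_def F psd_sqrt_spectral[OF Q] mat_log_spectral[OF Q])
qed

section \<open>The logarithm as an integral\<close>

lemma
  fixes A :: "real^'n^'n"
  assumes "det A \<noteq> 0"
  shows matrix_inv_left: "matrix_inv A ** A = mat 1"
    and matrix_inv_right: "A ** matrix_inv A = mat 1"
proof -
  have "\<exists>B. A ** B = mat 1 \<and> B ** A = mat 1"
    using assms unfolding invertible_det_nz[symmetric] invertible_def .
  from someI_ex[OF this] show "matrix_inv A ** A = mat 1" "A ** matrix_inv A = mat 1"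
    unfolding matrix_inv_def by auto
qed

lemma continuous_on_det [continuous_intros]:
  fixes f :: "'a::topological_space \<Rightarrow> real^'n^'n"
  assumes "continuous_on S f"
  shows "continuous_on S (\<lambda>x. det (f x))"
  unfolding det_def by (intro continuous_intros assms)

text \<open>Cramer's rule. As quotients of determinants the entries of the inverse depend
  continuously on those of \<open>A\<close>.\<close>

lemma matrix_inv_component:
  fixes A :: "real^'n^'n"
  assumes A: "det A \<noteq> 0"
  shows "matrix_inv A $ i $ k = det (\<chi> i' j. if j = i then axis k 1 $ i' else A $ i' $ j) / det A"
proof -
  have "A *v (matrix_inv A *v axis k 1) = axis k 1"
    by (simp add: matrix_vector_mul_assoc matrix_inv_right[OF A])
  then have "matrix_inv A *v axis k 1
      = (\<chi> i. det (\<chi> i' j. if j = i then axis k 1 $ i' else A $ i' $ j) / det A)"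
    by (simp only: cramer[OF A])
  moreover have "(matrix_inv A *v axis k 1) $ i = matrix_inv A $ i $ k"
    by (simp add: matrix_vector_mult_def axis_def if_distrib [of "\<lambda>x. _ * x"] cong: if_cong)
  ultimately show ?thesis by simp
qed

lemma continuous_on_matrix_inv [continuous_intros]:
  fixes f :: "'a::topological_space \<Rightarrow> real^'n^'n"
  assumes f: "continuous_on S f" and nz: "\<And>x. x \<in> S \<Longrightarrow> det (f x) \<noteq> 0"
  shows "continuous_on S (\<lambda>x. matrix_inv (f x))"
proof -
  have "continuous_on S (\<lambda>x. if j = i then axis k 1 $ i' else f x $ i' $ j)" for i j k i'
    by (cases "j = i") (auto intro!: continuous_intros f)
  then have "continuous_on S (\<lambda>x. \<chi> i k.
      det (\<chi> i' j. if j = i then axis k 1 $ i' else f x $ i' $ j) / det (f x))"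
    by (auto intro!: continuous_intros f simp: nz)
  then show ?thesis
    by (rule continuous_on_eq) (simp add: vec_eq_iff matrix_inv_component nz)
qed

lemma open_det_nonzero: "open {A :: real^'n^'n. det A \<noteq> 0}"
  by (intro open_Collect_neq continuous_intros)

text \<open>By the resolvent identity the remainder at \<open>B\<close> is
  \<open>(A^-1 - B^-1) (B - A) A^-1\<close>, which is of smaller order than \<open>B - A\<close>
  because the inverse is continuous.\<close>

lemma matrix_inv_has_derivative:
  fixes A :: "real^'n^'n"
  assumes A: "det A \<noteq> 0"
  shows "(matrix_inv has_derivative (\<lambda>H. - (matrix_inv A ** H ** matrix_inv A))) (at A)"
proof -
  obtain K where K: "K > 0" "\<And>(B :: real^'n^'n) (C :: real^'n^'n). norm (B ** C) \<le> norm B * norm C * K"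
    using matrix_mult.pos_bounded by blast
  let ?r = "\<lambda>B. matrix_inv B - matrix_inv A + (matrix_inv A ** (B - A) ** matrix_inv A)"
  let ?b = "\<lambda>B. norm (matrix_inv B - matrix_inv A) * (norm (matrix_inv A) * K * K)"
  have ev: "eventually (\<lambda>B. det B \<noteq> 0) (at A)"
    unfolding eventually_at_topological using open_det_nonzero A by blast
  have r: "norm (?r B) / norm (B - A) \<le> ?b B" if "det B \<noteq> 0" for B
  proof -
    have "matrix_inv B ** (B - A) ** matrix_inv A = matrix_inv A - matrix_inv B"
      using matrix_inv_left[OF that] matrix_inv_right[OF A]
      by (simp add: matrix_mult.diff_right matrix_mult.diff_left flip: matrix_mul_assoc)
    then have eq: "?r B = (matrix_inv A - matrix_inv B) ** (B - A) ** matrix_inv A"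
      by (simp add: matrix_mult.diff_left)
    have "norm (?r B) \<le> norm ((matrix_inv A - matrix_inv B) ** (B - A)) * norm (matrix_inv A) * K"
      unfolding eq by (rule K)
    also have "\<dots> \<le> norm (matrix_inv A - matrix_inv B) * norm (B - A) * K * norm (matrix_inv A) * K"
      using K by (intro mult_right_mono) auto
    finally show ?thesis
      by (cases "B = A") (simp_all add: divide_le_eq norm_minus_commute mult_ac)
  qed
  have "continuous_on {A :: real^'n^'n. det A \<noteq> 0} matrix_inv"
    by (intro continuous_on_matrix_inv continuous_on_id) auto
  then have "continuous (at A) matrix_inv"
    using A by (simp add: continuous_on_eq_continuous_at[OF open_det_nonzero])
  then have "((\<lambda>B. matrix_inv B - matrix_inv A) \<longlongrightarrow> 0) (at A)"
    by (simp add: continuous_within LIM_zero)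
  then have "(?b \<longlongrightarrow> 0) (at A)"
    by (intro tendsto_mult_left_zero tendsto_norm_zero)
  then have "((\<lambda>B. norm (?r B) / norm (B - A)) \<longlongrightarrow> 0) (at A)"
    by - (rule tendsto_sandwich[OF _ eventually_mono[OF ev r] tendsto_const], auto)
  moreover have "bounded_linear (\<lambda>H. - (matrix_inv A ** H ** matrix_inv A))"
    by (intro bounded_linear_minus bounded_linear_compose[OF matrix_mult.bounded_linear_left]
        matrix_mult.bounded_linear_right)
  ultimately show ?thesis
    by (simp add: has_derivative_iff_norm)
qed

text \<open>Only the quadratic form is constrained. This gives a convex set, as differentiation
  under the integral requires, on which segments from \<open>mat 1\<close> stay invertible.\<close>

definition pos_def :: "(real^'n^'n) set" where
  "pos_def = {X. \<forall>x. x \<noteq> 0 \<longrightarrow> x \<bullet> (X *v x) > 0}"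

lemma PSym_imp_pos_def: "X \<in> PSym \<Longrightarrow> X \<in> pos_def"
  by (simp add: PSym_def pos_def_def)

lemma convex_pos_def: "convex pos_def"
proof (rule convexI)
  fix X Y :: "real^'n^'n" and u v :: real
  assume *: "X \<in> pos_def" "Y \<in> pos_def" "0 \<le> u" "0 \<le> v" "u + v = 1"
  have "0 < u * (x \<bullet> (X *v x)) + v * (x \<bullet> (Y *v x))" if "x \<noteq> 0" for x
  proof (cases "u = 0")
    case False
    then show ?thesis using * that by (intro add_pos_nonneg) (auto simp: pos_def_def less_imp_le)
  qed (use * that in \<open>auto simp: pos_def_def\<close>)
  then show "u *\<^sub>R X + v *\<^sub>R Y \<in> pos_def"
    by (simp add: pos_def_def matrix_vector_mult_add_rdistrib inner_add_right
        flip: scaleR_matrix_vector_assoc)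
qed

text \<open>The inverse of \<open>(1 - s) 1 + s X\<close>, the point at parameter \<open>s\<close>
  on the segment from \<open>mat 1\<close> to \<open>X\<close>. It is a resolvent of
  \<open>X\<close> up to scaling, reparametrised to a compact interval.\<close>

definition resolvent :: "real^'n^'n \<Rightarrow> real \<Rightarrow> real^'n^'n" where
  "resolvent X s = matrix_inv (mat 1 + s *\<^sub>R (X - mat 1))"

lemma det_segment_nonzero:
  assumes X: "X \<in> pos_def" and s: "s \<in> {0..1}"
  shows "det (mat 1 + s *\<^sub>R (X - mat 1)) \<noteq> 0"
proof -
  have "mat 1 \<in> pos_def" by (simp add: pos_def_def)
  then have "(1 - s) *\<^sub>R mat 1 + s *\<^sub>R X \<in> pos_def"
    using s by (intro convexD[OF convex_pos_def _ X]) auto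
  moreover have "(1 - s) *\<^sub>R mat 1 + s *\<^sub>R X = mat 1 + s *\<^sub>R (X - mat 1)"
    by (simp add: algebra_simps)
  ultimately have "mat 1 + s *\<^sub>R (X - mat 1) \<in> pos_def" by simp
  then have "\<forall>x. (mat 1 + s *\<^sub>R (X - mat 1)) *v x = 0 \<longrightarrow> x = 0"
    unfolding pos_def_def by force
  then show ?thesis
    by (simp only: invertible_det_nz[symmetric] invertible_left_inverse matrix_left_invertible_ker)
qed

text \<open>With \<open>R\<close> the resolvent, the product rule gives
  \<open>(1 - s (X - 1) R) H R\<close>, and the bracket equals \<open>R\<close> since
  \<open>R\<close> inverts \<open>1 + s (X - 1)\<close>.\<close>

lemma resolvent_has_derivative:
  assumes X: "X \<in> pos_def" and s: "s \<in> {0..1}"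
  shows "((\<lambda>X. (X - mat 1) ** resolvent X s) has_derivative
    (\<lambda>H. resolvent X s ** H ** resolvent X s)) (at X within S)"
proof -
  let ?R = "resolvent X s"
  have 1: "((\<lambda>X. mat 1 + s *\<^sub>R (X - mat 1)) has_derivative (\<lambda>H. s *\<^sub>R H)) (at X within S)"
    by (auto intro!: derivative_eq_intros)
  have "((\<lambda>X. resolvent X s) has_derivative (\<lambda>H. - (?R ** (s *\<^sub>R H) ** ?R))) (at X within S)"
    unfolding resolvent_def
    by (rule has_derivative_compose[OF 1 matrix_inv_has_derivative[OF det_segment_nonzero[OF X s]]])
  moreover have "((\<lambda>X. X - mat 1) has_derivative (\<lambda>H. H)) (at X within S)"
    by (auto intro!: derivative_eq_intros)
  ultimately have "((\<lambda>X. (X - mat 1) ** resolvent X s) has_derivative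
      (\<lambda>H. (X - mat 1) ** - (?R ** (s *\<^sub>R H) ** ?R) + H ** ?R)) (at X within S)"
    by (rule matrix_mult.FDERIV[rotated])
  moreover have "(X - mat 1) ** - (?R ** (s *\<^sub>R H) ** ?R) + H ** ?R = ?R ** H ** ?R" for H
  proof -
    have "?R + (s *\<^sub>R (X - mat 1)) ** ?R = mat 1"
      using matrix_inv_right[OF det_segment_nonzero[OF X s]] unfolding resolvent_def
      by (simp add: matrix_mult.add_left)
    then have "?R ** (H ** ?R) + (s *\<^sub>R (X - mat 1)) ** ?R ** (H ** ?R) = H ** ?R"
      by (simp flip: matrix_mult.add_left)
    then show ?thesis
      by (simp add: matrix_mult.minus_right matrix_mult.scaleR_left matrix_mult.scaleR_right
          matrix_mul_assoc) (simp add: add_eq_0_iff algebra_simps del: scaleR_diff_right)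
  qed
  ultimately show ?thesis by simp
qed

lemma continuous_on_resolvent:
  "continuous_on (pos_def \<times> {0..1}) (\<lambda>z. resolvent (fst z) (snd z))"
  unfolding resolvent_def by (intro continuous_intros) (auto dest!: det_segment_nonzero)

definition log_int :: "real^'n^'n \<Rightarrow> real^'n^'n" where
  "log_int X = integral {0..1} (\<lambda>s. (X - mat 1) ** resolvent X s)"

definition dlog_int :: "real^'n^'n \<Rightarrow> real^'n^'n \<Rightarrow> real^'n^'n" where
  "dlog_int X H = integral {0..1} (\<lambda>s. resolvent X s ** H ** resolvent X s)"

lemma continuous_on_resolvent_at:
  assumes X: "X \<in> pos_def"
  shows "continuous_on {0..1} (resolvent X)"
proof -
  have "continuous_on {0..1} (\<lambda>s. resolvent (fst (X, s)) (snd (X, s)))"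
    by (rule continuous_on_compose2[OF continuous_on_resolvent]) (use X in \<open>auto intro!: continuous_intros\<close>)
  then show ?thesis by simp
qed

lemma dlog_int_integrable:
  assumes X: "X \<in> pos_def"
  shows "(\<lambda>s. resolvent X s ** H ** resolvent X s) integrable_on {0..1}"
  by (intro integrable_continuous_real matrix_mult.continuous_on continuous_intros
      continuous_on_resolvent_at X)

text \<open>Differentiation under the integral sign on the convex set \<open>pos_def\<close>. The
  Leibniz rule wants the derivative of the integrand as a continuous family of bounded linear maps,
  hence \<open>Blinfun\<close>; evaluation at \<open>H\<close> removes it again.\<close>

lemma log_int_has_derivative:
  assumes X: "X \<in> pos_def"
  shows "(log_int has_derivative dlog_int X) (at X within pos_def)"
proof -
  let ?f = "\<lambda>X s. Blinfun (\<lambda>H. resolvent X s ** H ** resolvent X s)"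
  have bl: "bounded_linear (\<lambda>H. resolvent X s ** H ** resolvent X s)" for X s
    by (intro bounded_linear_compose[OF matrix_mult.bounded_linear_left]
        matrix_mult.bounded_linear_right)
  note app = bounded_linear_Blinfun_apply[OF bl]
  have cont: "continuous_on (pos_def \<times> {0..1}) (\<lambda>(X, s). ?f X s)"
    unfolding split_beta
    by (intro continuous_on_blinfun_componentwise)
      (simp add: app, intro matrix_mult.continuous_on continuous_on_resolvent continuous_intros)
  have "((\<lambda>X. integral (cbox 0 1) (\<lambda>s. (X - mat 1) ** resolvent X s)) has_derivative
      integral (cbox 0 1) (?f X)) (at X within pos_def)"
  proof (rule leibniz_rule[OF _ _ _ X convex_pos_def])
    show "continuous_on (pos_def \<times> cbox 0 1) (\<lambda>(X, s). ?f X s)" using cont by simp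
  next
    fix X :: "real^'n^'n" and s :: real
    assume "X \<in> pos_def" "s \<in> cbox 0 1"
    then show "((\<lambda>X. (X - mat 1) ** resolvent X s) has_derivative blinfun_apply (?f X s))
        (at X within pos_def)"
      unfolding app by (intro resolvent_has_derivative) auto
  next
    fix X :: "real^'n^'n" assume "X \<in> pos_def"
    then show "(\<lambda>s. (X - mat 1) ** resolvent X s) integrable_on cbox 0 1"
      by (auto intro!: integrable_continuous_real matrix_mult.continuous_on continuous_intros
      continuous_on_resolvent_at)
  qed
  moreover have "blinfun_apply (integral (cbox 0 1) (?f X)) = dlog_int X"
  proof
    fix H
    have "continuous_on {0..1} (\<lambda>s. case (X, s) of (X, s) \<Rightarrow> ?f X s)"
      by (rule continuous_on_compose2[OF cont]) (use X in \<open>auto intro!: continuous_intros\<close>)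
    then have "?f X integrable_on cbox 0 1" by (simp add: integrable_continuous_real)
    then show "blinfun_apply (integral (cbox 0 1) (?f X)) H = dlog_int X H"
      by (simp add: blinfun_apply_integral app dlog_int_def)
  qed
  ultimately show ?thesis by (simp add: log_int_def[abs_def])
qed

text \<open>Base point and direction vary together, because the direction used later,
  \<open>F^T H + H^T F\<close>, depends on \<open>F\<close> as well.\<close>

lemma continuous_on_dlog_int:
  assumes f: "continuous_on S f" "f ` S \<subseteq> pos_def" and h: "continuous_on S h"
  shows "continuous_on S (\<lambda>x. dlog_int (f x) (h x))"
proof -
  have "continuous_on (S \<times> {0..1}) (\<lambda>z. resolvent (f (fst z)) (snd z))"
    using continuous_on_compose2[OF continuous_on_resolvent, of "S \<times> {0..1}" "\<lambda>z. (f (fst z), snd z)"] f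
    by (fastforce intro!: continuous_intros continuous_on_compose2[OF f(1)])
  then have "continuous_on (S \<times> cbox 0 1)
      (\<lambda>(x, s). resolvent (f x) s ** h x ** resolvent (f x) s)"
    unfolding split_beta by (auto intro!: matrix_mult.continuous_on continuous_on_compose2[OF h]
      continuous_intros)
  from integral_continuous_on_param[OF this] show ?thesis by (simp add: dlog_int_def)
qed

section \<open>Scalar inequalities\<close>

text \<open>The first divided difference of \<open>ln\<close>, with the derivative on the diagonal.
  In an eigenbasis these are the multipliers of the derivative of the matrix logarithm
  (Daleckii-Krein).\<close>

definition log_slope :: "real \<Rightarrow> real \<Rightarrow> real" where
  "log_slope a b = (if a = b then 1 / a else (ln a - ln b) / (a - b))"

lemma segment_pos:
  assumes "a > 0" "s \<in> {0..1}"
  shows "0 < 1 + s * (a - 1 :: real)"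
proof (cases "s = 1")
  case False
  then have "0 < (1 - s) + s * a" using assms by (intro add_pos_nonneg) auto
  then show ?thesis by (simp add: algebra_simps)
qed (use assms in auto)

lemma has_integral_ln:
  fixes a :: real
  assumes a: "a > 0"
  shows "((\<lambda>s. (a - 1) / (1 + s * (a - 1))) has_integral ln a) {0..1}"
proof -
  have "((\<lambda>s. ln (1 + s * (a - 1))) has_real_derivative (a - 1) / (1 + s * (a - 1))) (at s within {0..1})"
    if "s \<in> {0..1}" for s
    using segment_pos[OF a that] by (auto intro!: derivative_eq_intros)
  then show ?thesis
    using fundamental_theorem_of_calculus[of 0 1 "\<lambda>s. ln (1 + s * (a - 1))"]
    by (fastforce simp: has_real_derivative_iff_has_vector_derivative)
qed

lemma has_integral_log_slope:
  fixes a b :: real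
  assumes a: "a > 0" and b: "b > 0"
  shows "((\<lambda>s. 1 / (1 + s * (a - 1)) * (1 / (1 + s * (b - 1)))) has_integral log_slope a b) {0..1}"
proof -
  \<comment> \<open>An antiderivative vanishing at 0, found by partial fractions when
    \<open>a\<close> and \<open>b\<close> differ.\<close>
  define f where "f s = (if a = b then s / (1 + s * (a - 1)) else
    (ln (1 + s * (a - 1)) - ln (1 + s * (b - 1))) / (a - b))" for s
  have "(f has_real_derivative 1 / (1 + s * (a - 1)) * (1 / (1 + s * (b - 1)))) (at s within {0..1})"
    if s: "s \<in> {0..1}" for s
  proof -
    have pos: "1 + s * (a - 1) > 0" "1 + s * (b - 1) > 0" using segment_pos s a b by auto
    show ?thesis
    proof (cases "a = b")
      case True
      then show ?thesis unfolding f_def[abs_def] using pos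
        by (auto intro!: derivative_eq_intros simp: divide_simps)
    next
      case False
      have "(f has_real_derivative ((a - 1) / (1 + s * (a - 1)) - (b - 1) / (1 + s * (b - 1))) / (a - b))
          (at s within {0..1})"
        unfolding f_def[abs_def] using pos False
        by (auto intro!: derivative_eq_intros)
      moreover have "(a - 1) / (1 + s * (a - 1)) - (b - 1) / (1 + s * (b - 1))
          = (a - b) * (1 / (1 + s * (a - 1)) * (1 / (1 + s * (b - 1))))"
        using pos by (simp add: field_simps)
      ultimately show ?thesis using False by simp
    qed
  qed
  moreover have "f 1 - f 0 = log_slope a b" by (simp add: f_def log_slope_def)
  ultimately show ?thesis
    using fundamental_theorem_of_calculus[of 0 1 f "\<lambda>s. 1 / (1 + s * (a - 1)) * (1 / (1 + s * (b - 1)))"]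
    by (simp add: has_real_derivative_iff_has_vector_derivative)
qed

lemma log_slope_commute: "log_slope a b = log_slope b a"
  by (simp add: log_slope_def) (metis minus_diff_eq minus_divide_divide)

text \<open>The difference of both sides vanishes at 1 and has derivative
  \<open>(x - 1)^2 / (x (x + 1)^2)\<close>.\<close>

lemma ln_ge_Pade:
  assumes "t \<ge> (1::real)"
  shows "2 * (t - 1) / (t + 1) \<le> ln t"
proof -
  have "(\<lambda>t. ln t - 2 * (t - 1) / (t + 1)) 1 \<le> (\<lambda>t. ln t - 2 * (t - 1) / (t + 1)) t"
  proof (rule DERIV_nonneg_imp_nondecreasing[OF assms])
    fix x :: real assume x: "1 \<le> x"
    have "((\<lambda>t. ln t - 2 * (t - 1) / (t + 1)) has_real_derivative
        1 / x - (2 * (x + 1) - 2 * (x - 1)) / ((x + 1) * (x + 1))) (at x)"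
      using x by (auto intro!: derivative_eq_intros)
    moreover have "1 / x - (2 * (x + 1) - 2 * (x - 1)) / ((x + 1) * (x + 1)) = (x - 1)\<^sup>2 / (x * (x + 1)\<^sup>2)"
      using x by (simp add: divide_simps) (simp add: power2_eq_square algebra_simps)
    ultimately have "((\<lambda>t. ln t - 2 * (t - 1) / (t + 1)) has_real_derivative
        (x - 1)\<^sup>2 / (x * (x + 1)\<^sup>2)) (at x)" by simp
    then show "\<exists>y. ((\<lambda>t. ln t - 2 * (t - 1) / (t + 1)) has_real_derivative y) (at x) \<and> 0 \<le> y"
      using x by (intro exI conjI) auto
  qed
  then show ?thesis by simp
qed

text \<open>For \<open>t = \<alpha> / \<beta>\<close> the bound on \<open>ln\<close> reads
  \<open>d >= 2 (\<alpha> - \<beta>) / (\<alpha> + \<beta>)\<close>, while the slope is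
  \<open>2 d / ((\<alpha> - \<beta>) (\<alpha> + \<beta>))\<close>. Multiplying out gives the first
  estimate, and one more factor \<open>d >= 0\<close> the second.\<close>

lemma log_slope_bounds:
  assumes "0 < \<beta>" "\<beta> < \<alpha>"
  defines "d \<equiv> ln \<alpha> - ln \<beta>"
  shows "4 \<le> log_slope (\<alpha>\<^sup>2) (\<beta>\<^sup>2) * (\<alpha> + \<beta>)\<^sup>2" and "log_slope (\<alpha>\<^sup>2) (\<beta>\<^sup>2) * (\<alpha> - \<beta>)\<^sup>2 \<le> d\<^sup>2"
proof -
  have "2 * (\<alpha> / \<beta> - 1) / (\<alpha> / \<beta> + 1) \<le> ln (\<alpha> / \<beta>)" using assms by (intro ln_ge_Pade) simp
  moreover have "\<alpha> / \<beta> - 1 = (\<alpha> - \<beta>) / \<beta>" "\<alpha> / \<beta> + 1 = (\<alpha> + \<beta>) / \<beta>"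
    using assms by (simp_all add: field_simps)
  then have "2 * (\<alpha> / \<beta> - 1) / (\<alpha> / \<beta> + 1) = 2 * (\<alpha> - \<beta>) / (\<alpha> + \<beta>)"
    using assms by simp
  ultimately have d: "2 * (\<alpha> - \<beta>) / (\<alpha> + \<beta>) \<le> d" using assms by (simp add: d_def ln_div)
  have g: "log_slope (\<alpha>\<^sup>2) (\<beta>\<^sup>2) = 2 * d / ((\<alpha> - \<beta>) * (\<alpha> + \<beta>))"
  proof -
    have "\<beta>\<^sup>2 < \<alpha>\<^sup>2" using assms by (intro power_strict_mono) auto
    then have "log_slope (\<alpha>\<^sup>2) (\<beta>\<^sup>2) = (2 * ln \<alpha> - 2 * ln \<beta>) / (\<alpha>\<^sup>2 - \<beta>\<^sup>2)"
      using assms by (simp add: log_slope_def ln_realpow)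
    moreover have "\<alpha>\<^sup>2 - \<beta>\<^sup>2 = (\<alpha> - \<beta>) * (\<alpha> + \<beta>)" by (simp add: power2_eq_square algebra_simps)
    ultimately show ?thesis by (simp add: d_def)
  qed
  have "4 \<le> 2 * d * (\<alpha> + \<beta>) / (\<alpha> - \<beta>)" using d assms by (simp add: field_simps)
  then show "4 \<le> log_slope (\<alpha>\<^sup>2) (\<beta>\<^sup>2) * (\<alpha> + \<beta>)\<^sup>2"
    unfolding g using assms by (simp add: power2_eq_square)
  have "0 \<le> 2 * (\<alpha> - \<beta>) / (\<alpha> + \<beta>)" using assms by simp
  then have "d * (2 * (\<alpha> - \<beta>) / (\<alpha> + \<beta>)) \<le> d * d" using d by (intro mult_left_mono) auto
  then show "log_slope (\<alpha>\<^sup>2) (\<beta>\<^sup>2) * (\<alpha> - \<beta>)\<^sup>2 \<le> d\<^sup>2"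
    unfolding g using assms(1,2) by (simp add: power2_eq_square mult_ac)
qed

lemma log_slope_sqrt_bounds:
  assumes "0 < a" "0 < b"
  shows "4 \<le> log_slope a b * (sqrt a + sqrt b)\<^sup>2"
    and "log_slope a b * (sqrt a - sqrt b)\<^sup>2 \<le> ((ln a - ln b) / 2)\<^sup>2"
proof -
  have *: "(sqrt a)\<^sup>2 = a" "(sqrt b)\<^sup>2 = b" "ln (sqrt a) = ln a / 2" "ln (sqrt b) = ln b / 2"
    using assms by (simp_all add: ln_sqrt del: eq_divide_eq_numeral1)
  consider "a = b" | "b < a" | "a < b" by linarith
  then have "4 \<le> log_slope a b * (sqrt a + sqrt b)\<^sup>2 \<and>
    log_slope a b * (sqrt a - sqrt b)\<^sup>2 \<le> ((ln a - ln b) / 2)\<^sup>2"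
  proof cases
    case 1
    then show ?thesis using assms by (simp add: log_slope_def power2_eq_square)
  next
    case 2
    then show ?thesis using log_slope_bounds[of "sqrt b" "sqrt a"] assms
      by (simp only: * real_sqrt_less_iff real_sqrt_gt_0_iff diff_divide_distrib)
  next
    case 3
    then show ?thesis using log_slope_bounds[of "sqrt a" "sqrt b"] assms
      by (simp only: * real_sqrt_less_iff real_sqrt_gt_0_iff diff_divide_distrib log_slope_commute[of a]
          add.commute[of "sqrt a"] power2_commute[of "sqrt a"] power2_commute[of "ln a / 2"])
  qed
  then show "4 \<le> log_slope a b * (sqrt a + sqrt b)\<^sup>2"
    "log_slope a b * (sqrt a - sqrt b)\<^sup>2 \<le> ((ln a - ln b) / 2)\<^sup>2" by auto
qed

lemma log_slope_pos:
  assumes "0 < a" "0 < b"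
  shows "0 < log_slope a b"
  using log_slope_sqrt_bounds(1)[OF assms] by (smt (verit) mult_nonpos_nonneg zero_le_power2)

text \<open>Completing a square bounds the bracket in \<open>k\<close> below by
  \<open>(sqrt a + sqrt b)^2\<close> or by \<open>(sqrt a - sqrt b)^2\<close> times the product. The
  sign of the product decides whether the lower or the upper bound on the slope is then
  usable.\<close>

lemma pair_term_bounds:
  fixes a b x y u v :: real
  assumes a: "0 < a" and b: "0 < b"
  defines "k \<equiv> log_slope a b * (a * x\<^sup>2 * v\<^sup>2 + b * y\<^sup>2 * u\<^sup>2 + (a + b) * ((x * u) * (y * v)))"
  shows "0 \<le> (x * u) * (y * v) \<Longrightarrow> 4 * ((x * u) * (y * v)) \<le> k"
    and "(x * u) * (y * v) \<le> 0 \<Longrightarrow> ((ln a - ln b) / 2)\<^sup>2 * ((x * u) * (y * v)) \<le> k"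
proof -
  let ?\<alpha> = "sqrt a" and ?\<beta> = "sqrt b" and ?p = "(x * u) * (y * v)" and ?g = "log_slope a b"
  have sq: "?\<alpha>\<^sup>2 = a" "?\<beta>\<^sup>2 = b" using a b by auto
  have g: "0 \<le> ?g" using log_slope_pos[OF a b] by simp
  have "?\<alpha>\<^sup>2 * x\<^sup>2 * v\<^sup>2 + ?\<beta>\<^sup>2 * y\<^sup>2 * u\<^sup>2 + (?\<alpha>\<^sup>2 + ?\<beta>\<^sup>2) * ?p - (?\<alpha> + ?\<beta>)\<^sup>2 * ?p
      = (?\<alpha> * x * v - ?\<beta> * y * u)\<^sup>2" by algebra
  then have m: "0 \<le> a * x\<^sup>2 * v\<^sup>2 + b * y\<^sup>2 * u\<^sup>2 + (a + b) * ?p - (?\<alpha> + ?\<beta>)\<^sup>2 * ?p"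
    unfolding sq by simp
  have "?\<alpha>\<^sup>2 * x\<^sup>2 * v\<^sup>2 + ?\<beta>\<^sup>2 * y\<^sup>2 * u\<^sup>2 + (?\<alpha>\<^sup>2 + ?\<beta>\<^sup>2) * ?p - (?\<alpha> - ?\<beta>)\<^sup>2 * ?p
      = (?\<alpha> * x * v + ?\<beta> * y * u)\<^sup>2" by algebra
  then have n: "0 \<le> a * x\<^sup>2 * v\<^sup>2 + b * y\<^sup>2 * u\<^sup>2 + (a + b) * ?p - (?\<alpha> - ?\<beta>)\<^sup>2 * ?p"
    unfolding sq by simp
  show "4 * ?p \<le> k" if "0 \<le> ?p"
  proof -
    have "4 * ?p \<le> ?g * (?\<alpha> + ?\<beta>)\<^sup>2 * ?p"
      using log_slope_sqrt_bounds(1)[OF a b] that by (rule mult_right_mono)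
    also have "\<dots> \<le> k" unfolding k_def mult.assoc[of ?g]
      using g m by (intro mult_left_mono) auto
    finally show ?thesis .
  qed
  show "((ln a - ln b) / 2)\<^sup>2 * ?p \<le> k" if "?p \<le> 0"
  proof -
    have "((ln a - ln b) / 2)\<^sup>2 * ?p \<le> ?g * (?\<alpha> - ?\<beta>)\<^sup>2 * ?p"
      using log_slope_sqrt_bounds(2)[OF a b] that by (rule mult_right_mono_neg)
    also have "\<dots> \<le> k" unfolding k_def mult.assoc[of ?g]
      using g n by (intro mult_left_mono) auto
    finally show ?thesis .
  qed
qed

text \<open>The hypothesis says that \<open>x\<close>, \<open>z\<close> and \<open>- x - z\<close>
  have square sum at most 2/3. The form is \<open>A P^2 + B r^2 + m P r\<close> with nonnegative
  \<open>A\<close> and \<open>B\<close>. If \<open>m\<close> can be negative, it is at least -1/6,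
  which \<open>A * B >= 1/9\<close> outweighs.\<close>

lemma two_direction_form_nonneg:
  fixes x z P r :: real
  assumes xz: "x\<^sup>2 + z\<^sup>2 + x * z \<le> 1 / 3" and P: "0 \<le> P" and r: "0 \<le> r"
  shows "0 \<le> P\<^sup>2 + r\<^sup>2 - (x - z)\<^sup>2 / 2 * P * r - (P - r)\<^sup>2 / 3 - (P - r) * (x * P - z * r)"
proof -
  define A B u m where "A = 2/3 - x" and "B = 2/3 - z" and "u = x + z" and "m = 2/3 - (x - z)\<^sup>2 / 2 + u"
  have eq: "P\<^sup>2 + r\<^sup>2 - (x - z)\<^sup>2 / 2 * P * r - (P - r)\<^sup>2 / 3 - (P - r) * (x * P - z * r)
      = A * P\<^sup>2 + B * r\<^sup>2 + m * (P * r)"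
    by (simp add: A_def B_def m_def u_def power2_eq_square field_simps)
  have "x\<^sup>2 \<le> (2/3)\<^sup>2" "z\<^sup>2 \<le> (2/3)\<^sup>2"
    using xz zero_le_power2[of "x/2 + z"] zero_le_power2[of "z/2 + x"]
    by (simp_all add: power2_eq_square field_simps)
  then have AB: "0 \<le> A" "0 \<le> B"
    unfolding A_def B_def using power2_le_imp_le[of x "2/3"] power2_le_imp_le[of z "2/3"] by auto
  \<comment> \<open>The hypothesis, times 4, in terms of the sum and the difference of
    \<open>x\<close> and \<open>z\<close>.\<close>
  have d: "3 * u\<^sup>2 + (x - z)\<^sup>2 \<le> 4/3"
    using xz by (simp add: u_def power2_eq_square field_simps)
  have m: "m \<ge> u + 3 * u\<^sup>2 / 2" unfolding m_def using d by simp
  show ?thesis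
  proof (cases "0 \<le> u")
    case True
    then have "0 \<le> m" using m zero_le_power2[of u] by linarith
    then show ?thesis unfolding eq using AB P r by simp
  next
    case False
    \<comment> \<open>The lower bound for \<open>m\<close> equals
      \<open>3/2 (u + 1/3)^2 - 1/6\<close>.\<close>
    have "m \<ge> - 1/6" using m zero_le_power2[of "u + 1/3"] by (simp add: power2_eq_square field_simps)
    then have mPr: "m * (P * r) \<ge> - 1/6 * (P * r)" using P r by (intro mult_right_mono) auto
    \<comment> \<open>Here \<open>A * B = 4/9 - 2/3 u + x z\<close>, and \<open>d\<close> gives
      \<open>x z >= u^2 - 1/3\<close>; the claim follows from \<open>u < 0\<close>.\<close>
    have "1/9 \<le> A * B"
      using d False zero_le_power2[of u] by (simp add: A_def B_def u_def power2_eq_square field_simps)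
    then have "1/9 * (P * r)\<^sup>2 \<le> A * B * (P * r)\<^sup>2" by (rule mult_right_mono) simp
    moreover have "(A * P\<^sup>2 + B * r\<^sup>2)\<^sup>2 = (A * P\<^sup>2 - B * r\<^sup>2)\<^sup>2 + 4 * (A * B * (P * r)\<^sup>2)"
      by (simp add: power2_eq_square algebra_simps)
    moreover have "(1/6 * (P * r))\<^sup>2 = 1/36 * (P * r)\<^sup>2" by (simp add: power_mult_distrib power_divide)
    ultimately have "(1/6 * (P * r))\<^sup>2 \<le> (A * P\<^sup>2 + B * r\<^sup>2)\<^sup>2"
      using zero_le_power2[of "A * P\<^sup>2 - B * r\<^sup>2"] zero_le_power2[of "P * r"] by linarith
    then have "1/6 * (P * r) \<le> A * P\<^sup>2 + B * r\<^sup>2" using AB by - (rule power2_le_imp_le, auto)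
    then show ?thesis unfolding eq using mPr by linarith
  qed
qed

section \<open>The quadratic form in the three products and its nonnegativity\<close>

definition pair_bound :: "real \<Rightarrow> real \<Rightarrow> real \<Rightarrow> real" where
  "pair_bound z w p = (if 0 \<le> p then 4 * p else (z - w)\<^sup>2 * p)"

text \<open>
  The bound for the Hessian on \<open>\<xi> \<otimes> \<eta>\<close> in terms of the eigenvalues \<open>z\<^sub>i\<close> of \<open>dev log U\<close>;
  \<open>pair_bound\<close> bounds an off-diagonal pair of terms given only the product \<open>p\<^sub>i p\<^sub>j\<close>.
\<close>

definition ellipticity_form :: "real \<Rightarrow> real \<Rightarrow> real \<Rightarrow> real \<Rightarrow> real \<Rightarrow> real \<Rightarrow> real" where
  "ellipticity_form z1 z2 z3 p1 p2 p3 = 2 * (p1\<^sup>2 + p2\<^sup>2 + p3\<^sup>2)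
    + pair_bound z1 z2 (p1 * p2) + pair_bound z1 z3 (p1 * p3) + pair_bound z2 z3 (p2 * p3)
    - 2/3 * (p1 + p2 + p3)\<^sup>2 - 2 * (p1 + p2 + p3) * (z1 * p1 + z2 * p2 + z3 * p3)"

text \<open>Zero trace eliminates one eigenvalue. The upper bound 2/3 then follows from
  \<open>x^2 + x y + y^2 = 3/4 x^2 + (x/2 + y)^2\<close>.\<close>

lemma deviatoric_bounds:
  fixes z1 z2 z3 :: real
  assumes "z1 + z2 + z3 = 0" "z1\<^sup>2 + z2\<^sup>2 + z3\<^sup>2 \<le> 2/3"
  shows "z1\<^sup>2 + z3\<^sup>2 + z1 * z3 \<le> 1/3" and "z2\<^sup>2 + z3\<^sup>2 + z2 * z3 \<le> 1/3"
    and "z1 \<le> 2/3" "z2 \<le> 2/3" "z3 \<le> 2/3"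
proof -
  have "z2 = - z1 - z3" using assms by simp
  with assms(2) show 1: "z1\<^sup>2 + z3\<^sup>2 + z1 * z3 \<le> 1/3"
    by (simp add: power2_eq_square algebra_simps)
  have "z1 = - z2 - z3" using assms by simp
  with assms(2) show 2: "z2\<^sup>2 + z3\<^sup>2 + z2 * z3 \<le> 1/3"
    by (simp add: power2_eq_square algebra_simps)
  have *: "x \<le> 2/3" if "x\<^sup>2 + y\<^sup>2 + x * y \<le> 1/3" for x y :: real
  proof -
    have "x\<^sup>2 \<le> (2/3)\<^sup>2" using that zero_le_power2[of "x/2 + y"] by (simp add: power2_eq_square field_simps)
    then show ?thesis by (rule power2_le_imp_le) simp
  qed
  show "z1 \<le> 2/3" "z2 \<le> 2/3" using 1 2 * by auto
  show "z3 \<le> 2/3" using 2 by (intro *[of z3 z2]) (simp add: algebra_simps)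
qed

text \<open>With \<open>s\<close> the sum of the \<open>p\<close>, the pair terms complete the
  squares to \<open>2 s^2\<close>, and the form becomes
  \<open>2 s (2/3 s - (z1 p1 + z2 p2 + z3 p3))\<close>, where every \<open>z\<close> is at most
  2/3.\<close>

lemma ellipticity_form_nonneg_same_sign:
  assumes z: "z1 + z2 + z3 = 0" "z1\<^sup>2 + z2\<^sup>2 + z3\<^sup>2 \<le> 2/3" and p: "0 \<le> p1" "0 \<le> p2" "0 \<le> p3"
  shows "0 \<le> ellipticity_form z1 z2 z3 p1 p2 p3"
proof -
  let ?s = "p1 + p2 + p3"
  have "z1 * p1 + z2 * p2 + z3 * p3 \<le> 2/3 * p1 + 2/3 * p2 + 2/3 * p3"
    using deviatoric_bounds[OF z] p by (intro add_mono mult_right_mono) auto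
  then have "?s * (z1 * p1 + z2 * p2 + z3 * p3) \<le> ?s * (2/3 * ?s)"
    using p by (intro mult_left_mono) auto
  moreover have "ellipticity_form z1 z2 z3 p1 p2 p3
      = 4/3 * (?s * ?s) - 2 * (?s * (z1 * p1 + z2 * p2 + z3 * p3))"
    using p by (simp add: ellipticity_form_def pair_bound_def power2_eq_square algebra_simps)
  ultimately show ?thesis by (simp only: mult.left_commute[of ?s "2/3"])
qed

text \<open>For positive \<open>P = p1 + p2\<close>, half the form is the average of the
  two-variable forms at \<open>z1\<close> and \<open>z2\<close> with weights \<open>p1 / P\<close>
  and \<open>p2 / P\<close>: the terms without \<open>z1\<close> and \<open>z2\<close> involve
  \<open>p1\<close>, \<open>p2\<close> only through \<open>P\<close>, the others are linear in the
  weights.\<close>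

lemma ellipticity_form_nonneg_mixed_sign:
  assumes z: "z1 + z2 + z3 = 0" "z1\<^sup>2 + z2\<^sup>2 + z3\<^sup>2 \<le> 2/3" and p: "0 \<le> p1" "0 \<le> p2" "0 \<le> r"
  shows "0 \<le> ellipticity_form z1 z2 z3 p1 p2 (- r)"
proof (cases "p1 + p2 = 0")
  \<comment> \<open>The weights are undefined here; the form is just
    \<open>(4/3 - 2 z3) r^2\<close>.\<close>
  case True
  then have "p1 = 0" "p2 = 0" using p by auto
  moreover have "z3 * (r * r) \<le> 2/3 * (r * r)" using deviatoric_bounds(5)[OF z] by (rule mult_right_mono) simp
  ultimately show ?thesis
    by (simp add: ellipticity_form_def pair_bound_def power2_eq_square algebra_simps)
next
  case False
  define P where "P = p1 + p2"
  have P: "0 < P" using False p by (simp add: P_def)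
  let ?\<phi> = "\<lambda>x. P\<^sup>2 + r\<^sup>2 - (x - z3)\<^sup>2 / 2 * P * r - (P - r)\<^sup>2 / 3 - (P - r) * (x * P - z3 * r)"
  have neg: "pair_bound z w (p * (- r)) = - ((z - w)\<^sup>2 * (p * r))" if "0 \<le> p" for z w p
    using mult_nonneg_nonneg[OF that p(3)] by (auto simp: pair_bound_def)
  have "0 \<le> p1 * ?\<phi> z1 + p2 * ?\<phi> z2"
    using p P deviatoric_bounds(1,2)[OF z]
    by (intro add_nonneg_nonneg mult_nonneg_nonneg two_direction_form_nonneg) auto
  also have "\<dots> = P * (ellipticity_form z1 z2 z3 p1 p2 (- r) / 2)"
    unfolding ellipticity_form_def neg[OF p(1)] neg[OF p(2)] P_def
    using p by (simp add: pair_bound_def power2_eq_square field_simps)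
  finally show ?thesis using P by (simp add: zero_le_mult_iff)
qed

lemma pair_bound_commute: "pair_bound z w p = pair_bound w z p"
  by (simp add: pair_bound_def power2_commute)

lemma ellipticity_form_swap12:
  "ellipticity_form z1 z2 z3 p1 p2 p3 = ellipticity_form z2 z1 z3 p2 p1 p3"
  by (simp add: ellipticity_form_def pair_bound_commute[of z1 z2] mult_ac add_ac)

lemma ellipticity_form_swap23:
  "ellipticity_form z1 z2 z3 p1 p2 p3 = ellipticity_form z1 z3 z2 p1 p3 p2"
  by (simp add: ellipticity_form_def pair_bound_commute[of z2 z3] mult_ac add_ac)

lemma ellipticity_form_uminus:
  "ellipticity_form z1 z2 z3 p1 p2 p3 = ellipticity_form z1 z2 z3 (- p1) (- p2) (- p3)"
  by (simp add: ellipticity_form_def power2_eq_square algebra_simps)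

text \<open>Two of three reals always share a weak sign. Permuting indices and changing all signs
  makes these the first two, both nonnegative.\<close>

lemma ellipticity_form_nonneg:
  assumes z: "z1 + z2 + z3 = 0" "z1\<^sup>2 + z2\<^sup>2 + z3\<^sup>2 \<le> 2/3"
  shows "0 \<le> ellipticity_form z1 z2 z3 p1 p2 p3"
proof -
  have two: "0 \<le> ellipticity_form z1 z2 z3 p1 p2 p3"
    if z: "z1 + z2 + z3 = 0" "z1\<^sup>2 + z2\<^sup>2 + z3\<^sup>2 \<le> 2/3" and p: "0 \<le> p1" "0 \<le> p2"
    for z1 z2 z3 p1 p2 p3 :: real
    using ellipticity_form_nonneg_same_sign[OF z p] ellipticity_form_nonneg_mixed_sign[OF z p, of "- p3"]
    by (cases "0 \<le> p3") auto
  have one: "0 \<le> ellipticity_form z1 z2 z3 p1 p2 p3"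
    if z: "z1 + z2 + z3 = 0" "z1\<^sup>2 + z2\<^sup>2 + z3\<^sup>2 \<le> 2/3" and p: "0 \<le> p1"
    for z1 z2 z3 p1 p2 p3 :: real
  proof -
    consider "0 \<le> p2" | "0 \<le> p3" | "p2 \<le> 0" "p3 \<le> 0" by linarith
    then show ?thesis
    proof cases
      case 1
      then show ?thesis using two z p by blast
    next
      case 2
      then show ?thesis using 2 two[of z1 z3 z2 p1 p3 p2] z p ellipticity_form_swap23[of z1 z2 z3] by simp
    next
      case 3
      \<comment> \<open>A cyclic shift with a change of sign moves the nonpositive pair to the
        front.\<close>
      have "ellipticity_form z1 z2 z3 p1 p2 p3 = ellipticity_form z2 z3 z1 (- p2) (- p3) (- p1)"
        by (simp only: ellipticity_form_swap12[of z1] ellipticity_form_swap23[of z2 z1]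
          ellipticity_form_uminus[of z2 z3 z1 p2])
      then show ?thesis using 3 two[of z2 z3 z1 "- p2" "- p3" "- p1"] z p by simp
    qed
  qed
  show ?thesis
    using one[OF z, of p1 p2 p3] one[OF z, of "- p1" "- p2" "- p3"]
      ellipticity_form_uminus[of z1 z2 z3 p1 p2 p3]
    by (cases "0 \<le> p1") auto
qed

section \<open>Gradient and Hessian of the energy\<close>

context
  fixes Q :: "real^'n^'n" and c :: "'n \<Rightarrow> real"
  assumes Q: "orthogonal_matrix Q" and c: "\<And>k. 0 < c k"
begin

lemma resolvent_spectral:
  assumes s: "s \<in> {0..1}"
  shows "resolvent (spectral Q c) s = spectral Q (\<lambda>k. 1 / (1 + s * (c k - 1)))"
proof -
  have "mat 1 + s *\<^sub>R (spectral Q c - mat 1) = spectral Q (\<lambda>k. 1 + s * (c k - 1))"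
    by (simp only: spectral_1[OF Q, symmetric] spectral_diff spectral_scaleR spectral_add)
  moreover have "1 + s * (c k - 1) \<noteq> 0" for k using segment_pos[OF c s, of k] by simp
  ultimately show ?thesis by (simp add: resolvent_def matrix_inv_spectral[OF Q])
qed

text \<open>Eigenvalue by eigenvalue this is \<open>has_integral_ln\<close>. Together with
  \<open>mat_log_spectral\<close> it identifies the integral with the principal logarithm.\<close>

lemma log_int_spectral: "log_int (spectral Q c) = spectral Q (\<lambda>k. ln (c k))"
proof -
  have "((\<lambda>s. spectral Q (\<lambda>k. (c k - 1) / (1 + s * (c k - 1)))) has_integral spectral Q (\<lambda>k. ln (c k))) {0..1}"
    unfolding spectral_eq_sum
    by (intro has_integral_sum has_integral_scaleR_left has_integral_ln c) auto
  moreover have "(spectral Q c - mat 1) ** resolvent (spectral Q c) s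
      = spectral Q (\<lambda>k. (c k - 1) / (1 + s * (c k - 1)))" if "s \<in> {0..1}" for s
    by (simp add: resolvent_spectral[OF that] spectral_1[OF Q, symmetric] spectral_diff spectral_mult[OF Q])
  ultimately have "((\<lambda>s. (spectral Q c - mat 1) ** resolvent (spectral Q c) s) has_integral
      spectral Q (\<lambda>k. ln (c k))) {0..1}"
    using has_integral_cong by (metis (no_types, lifting))
  then show ?thesis unfolding log_int_def by (rule integral_unique)
qed

lemma inner_dlog_int:
  "M \<bullet> dlog_int (spectral Q c) H = integral {0..1} (\<lambda>s.
    let r = spectral Q (\<lambda>k. 1 / (1 + s * (c k - 1))) in M \<bullet> (r ** H ** r))"
proof -
  let ?R = "resolvent (spectral Q c)"
  have "M \<bullet> dlog_int (spectral Q c) H = integral {0..1} (\<lambda>s. M \<bullet> (?R s ** H ** ?R s))"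
    unfolding dlog_int_def
    using integral_linear[OF dlog_int_integrable[OF PSym_imp_pos_def[OF spectral_pos_def[OF Q c]]]
        bounded_linear_inner_right] by (simp add: o_def)
  also have "\<dots> = integral {0..1} (\<lambda>s. let r = spectral Q (\<lambda>k. 1 / (1 + s * (c k - 1))) in M \<bullet> (r ** H ** r))"
    by (intro integral_cong) (simp add: resolvent_spectral Let_def)
  finally show ?thesis .
qed

text \<open>Against a matrix that shares the eigenbasis, both resolvents can be moved to the left
  factor, where everything commutes. Only diagonal slopes \<open>1 / c k\<close> remain, as in the
  scalar chain rule.\<close>

lemma inner_spectral_dlog_int:
  "spectral Q e \<bullet> dlog_int (spectral Q c) H = spectral Q (\<lambda>k. e k / c k) \<bullet> H"
proof -
  have "((\<lambda>s. spectral Q (\<lambda>k. (1 / (1 + s * (c k - 1)) * (1 / (1 + s * (c k - 1)))) * e k) \<bullet> H) has_integral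
      spectral Q (\<lambda>k. log_slope (c k) (c k) * e k) \<bullet> H) {0..1}"
    unfolding spectral_eq_sum inner_sum_left inner_scaleR_left
    by (intro has_integral_sum has_integral_mult_left has_integral_log_slope c) auto
  moreover have "spectral Q e \<bullet> (spectral Q r ** H ** spectral Q r) = spectral Q (\<lambda>k. r k * r k * e k) \<bullet> H" for r
    by (subst inner_commute, subst inner_matrix_mult_right, subst inner_matrix_mult_left)
      (simp add: transpose_spectral spectral_mult[OF Q] mult_ac inner_commute[of H])
  moreover have "log_slope (c k) (c k) * e k = e k / c k" for k by (simp add: log_slope_def)
  ultimately show ?thesis
    unfolding inner_dlog_int Let_def by (simp add: integral_unique)
qed

lemma trace_dlog_int: "trace (dlog_int (spectral Q c) H) = spectral Q (\<lambda>k. 1 / c k) \<bullet> H"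
  using inner_spectral_dlog_int[of "\<lambda>_. 1" H] by (simp add: spectral_1[OF Q] inner_mat_1)

text \<open>For rank one directions the integrand factors into two resolvent forms; expanding their
  product leaves one scalar integral, a \<open>log_slope\<close>, for each pair of
  eigenvalues.\<close>

lemma inner_dlog_int_outer_product:
  defines "q \<equiv> \<lambda>x. transpose Q *v x"
  shows "x \<bullet> (dlog_int (spectral Q c) (outer_product u v) *v y) =
    (\<Sum>i\<in>UNIV. \<Sum>j\<in>UNIV. log_slope (c i) (c j) * ((q x $ i * q u $ i) * (q v $ j * q y $ j)))"
proof -
  let ?r = "\<lambda>s k. 1 / (1 + s * (c k - 1))"
  have "outer_product x y \<bullet> (spectral Q r ** outer_product u v ** spectral Q r)
      = (\<Sum>i\<in>UNIV. \<Sum>j\<in>UNIV. r i * r j * ((q x $ i * q u $ i) * (q v $ j * q y $ j)))" for r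
  proof -
    have "outer_product x y \<bullet> (spectral Q r ** outer_product u v ** spectral Q r)
        = (x \<bullet> (spectral Q r *v u)) * (v \<bullet> (spectral Q r *v y))"
      by (simp add: matrix_mult_outer_product outer_product_matrix_mult transpose_spectral
          inner_commute[of "outer_product x y"] inner_outer_product outer_product_vector_mult)
        (simp add: inner_commute[of _ x] inner_spectral_vector_mult mult_ac)
    also have "\<dots> = (\<Sum>i\<in>UNIV. \<Sum>j\<in>UNIV. r i * r j * ((q x $ i * q u $ i) * (q v $ j * q y $ j)))"
      unfolding inner_spectral_vector_mult sum_product q_def by (simp add: mult_ac)
    finally show ?thesis .
  qed
  moreover have "((\<lambda>s. \<Sum>i\<in>UNIV. \<Sum>j\<in>UNIV. ?r s i * ?r s j * ((q x $ i * q u $ i) * (q v $ j * q y $ j)))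
      has_integral (\<Sum>i\<in>UNIV. \<Sum>j\<in>UNIV. log_slope (c i) (c j) * ((q x $ i * q u $ i) * (q v $ j * q y $ j)))) {0..1}"
    by (intro has_integral_sum has_integral_mult_left has_integral_log_slope c) auto
  moreover have "x \<bullet> (dlog_int (spectral Q c) (outer_product u v) *v y)
      = outer_product x y \<bullet> dlog_int (spectral Q c) (outer_product u v)"
    by (simp add: inner_outer_product inner_commute[of "outer_product x y"])
  ultimately show ?thesis unfolding inner_dlog_int Let_def by (simp add: integral_unique)
qed

end

text \<open>Taken of \<open>F^T F\<close>, so on \<open>GL_plus\<close> it is twice the deviatoric
  logarithm of the stretch; hence the division by 4 in the energy.\<close>

definition dev_log :: "real^'n^'n \<Rightarrow> real^'n^'n" where
  "dev_log F = dev (log_int (transpose F ** F))"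

definition energy_grad :: "real^'n^'n \<Rightarrow> real^'n^'n" where
  "energy_grad F = transpose (matrix_inv F) ** dev_log F"

definition dev_log_deriv :: "real^'n^'n \<Rightarrow> real^'n^'n \<Rightarrow> real^'n^'n" where
  "dev_log_deriv F H = dev (dlog_int (transpose F ** F) (transpose F ** H + transpose H ** F))"

text \<open>The product rule applied to \<open>energy_grad\<close>. The value is a matrix, to be
  paired with the second direction by the inner product.\<close>

definition energy_hess :: "real^'n^'n \<Rightarrow> real^'n^'n \<Rightarrow> real^'n^'n" where
  "energy_hess F H = transpose (matrix_inv F) ** dev_log_deriv F H
    + transpose (- (matrix_inv F ** H ** matrix_inv F)) ** dev_log F"

lemma norm_dev_mat_log_right_stretch:
  fixes F :: "real^'n^'n"
  assumes F: "F \<in> GL_plus"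
  shows "(norm (dev (mat_log (right_stretch F))))\<^sup>2 = (norm (dev_log F))\<^sup>2 / 4"
proof -
  obtain Q c where Q: "orthogonal_matrix Q" "\<And>k. c k > 0" "transpose F ** F = spectral Q c"
    using F spectral_transpose_mult_self[of F] by (auto simp: GL_plus_def)
  have "mat_log (right_stretch F) = (1/2) *\<^sub>R log_int (transpose F ** F)"
    by (simp add: mat_log_right_stretch[OF Q] Q(3) log_int_spectral[OF Q(1,2)] spectral_scaleR)
  then show ?thesis
    by (simp add: dev_log_def linear_scale[OF linear_dev] power_divide)
qed

lemma transpose_mult_self_pos_def:
  fixes F :: "real^'n^'n"
  assumes F: "F \<in> GL_plus"
  shows "transpose F ** F \<in> pos_def"
proof -
  obtain Q c where "orthogonal_matrix Q" "\<And>k. c k > 0" "transpose F ** F = spectral Q c"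
    using F spectral_transpose_mult_self[of F] by (auto simp: GL_plus_def)
  then show ?thesis by (simp add: PSym_imp_pos_def spectral_pos_def)
qed

lemma open_GL_plus: "open (GL_plus :: (real^'n^'n) set)"
  unfolding GL_plus_def by (intro open_Collect_less continuous_intros)

lemma bounded_linear_transpose: "bounded_linear (transpose :: real^'n^'m \<Rightarrow> real^'m^'n)"
  by (simp add: linear_transpose linear_linear)

lemma bounded_linear_dev: "bounded_linear (dev :: real^'n^'n \<Rightarrow> real^'n^'n)"
  by (simp add: linear_dev linear_linear)

text \<open>The chain rule runs within \<open>GL_plus\<close>, which is mapped into
  \<open>pos_def\<close>; openness of \<open>GL_plus\<close> then gives the full derivative.\<close>

lemma dev_log_has_derivative:
  fixes F :: "real^'n^'n"
  assumes F: "F \<in> GL_plus"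
  shows "(dev_log has_derivative dev_log_deriv F) (at F)"
proof -
  have 1: "((\<lambda>F. transpose F ** F) has_derivative (\<lambda>H. transpose F ** H + transpose H ** F)) (at F within GL_plus)"
    by (intro matrix_mult.FDERIV bounded_linear.has_derivative[OF bounded_linear_transpose] has_derivative_ident)
  have "(log_int has_derivative dlog_int (transpose F ** F))
      (at (transpose F ** F) within (\<lambda>F. transpose F ** F) ` GL_plus)"
    by (rule has_derivative_subset[OF log_int_has_derivative[OF transpose_mult_self_pos_def[OF F]]])
      (auto intro: transpose_mult_self_pos_def)
  from has_derivative_in_compose[OF 1 this]
  have "((\<lambda>F. dev (log_int (transpose F ** F))) has_derivative
      (\<lambda>H. dev (dlog_int (transpose F ** F) (transpose F ** H + transpose H ** F)))) (at F within GL_plus)"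
    by (rule bounded_linear.has_derivative[OF bounded_linear_dev])
  then show ?thesis
    by (simp add: dev_log_def[abs_def] dev_log_deriv_def[abs_def] at_within_open[OF F open_GL_plus])
qed

text \<open>Pairing with \<open>dev_log F\<close> absorbs the outer \<open>dev\<close>, and the
  commuting case of \<open>dlog_int\<close> leaves \<open>?P\<close> paired with
  \<open>F^T H + H^T F\<close>. Since \<open>?P\<close> is symmetric, both summands contribute
  equally.\<close>

lemma energy_has_derivative:
  fixes F :: "real^'n^'n"
  assumes F: "F \<in> GL_plus"
  shows "((\<lambda>F. (norm (dev_log F))\<^sup>2 / 4) has_derivative (\<lambda>H. energy_grad F \<bullet> H)) (at F)"
proof -
  obtain Q c where Q: "orthogonal_matrix Q" "\<And>k. c k > 0" "transpose F ** F = spectral Q c"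
    using F spectral_transpose_mult_self[of F] by (auto simp: GL_plus_def)
  obtain e where e: "dev_log F = spectral Q e"
    by (simp add: dev_log_def Q(3) log_int_spectral[OF Q(1,2)] dev_spectral[OF Q(1)])
  let ?P = "spectral Q (\<lambda>k. e k / c k)"
  \<comment> \<open>As \<open>?P\<close> is \<open>(F^T F)^-1 dev_log F\<close>, the factor
    \<open>F\<close> leaves \<open>F^-T dev_log F\<close>.\<close>
  have FP: "F ** ?P = energy_grad F"
  proof -
    have "spectral Q c ** ?P = dev_log F"
      using Q(2) by (simp add: e spectral_mult[OF Q(1)] less_imp_neq[symmetric])
    then have "transpose F ** (F ** ?P) = dev_log F"
      by (simp add: Q(3)[symmetric] matrix_mul_assoc)
    then have "transpose (matrix_inv F) ** transpose F ** (F ** ?P) = energy_grad F"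
      by (simp add: energy_grad_def flip: matrix_mul_assoc)
    moreover have "transpose (matrix_inv F) ** transpose F = mat 1"
      using F by (simp add: GL_plus_def matrix_inv_right flip: matrix_transpose_mul)
    ultimately show ?thesis by simp
  qed
  have "dev_log F \<bullet> dev_log_deriv F H = 2 * (energy_grad F \<bullet> H)" for H
  proof -
    have "dev_log F \<bullet> dev_log_deriv F H = dev_log F \<bullet> dlog_int (spectral Q c) (transpose F ** H + transpose H ** F)"
      unfolding dev_log_def dev_log_deriv_def inner_dev_dev Q(3) ..
    also have "\<dots> = ?P \<bullet> (transpose F ** H) + ?P \<bullet> (transpose H ** F)"
      by (simp add: e inner_spectral_dlog_int[OF Q(1,2)] inner_add_right)
    also have "?P \<bullet> (transpose H ** F) = ?P \<bullet> (transpose F ** H)"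
      using inner_transpose[of ?P "transpose F ** H"]
      by (simp add: transpose_spectral matrix_transpose_mul transpose_transpose)
    also have "?P \<bullet> (transpose F ** H) = energy_grad F \<bullet> H"
      by (simp add: inner_matrix_mult_left flip: FP)
    finally show ?thesis by simp
  qed
  moreover have "((\<lambda>F. dev_log F \<bullet> dev_log F / 4) has_derivative
      (\<lambda>H. (dev_log F \<bullet> dev_log_deriv F H + dev_log_deriv F H \<bullet> dev_log F) / 4)) (at F)"
    by (auto intro!: derivative_eq_intros dev_log_has_derivative[OF F])
  ultimately show ?thesis
    by (simp add: power2_norm_eq_inner inner_commute[of "dev_log_deriv F _"])
qed

lemma energy_grad_has_derivative:
  fixes F :: "real^'n^'n"
  assumes F: "F \<in> GL_plus"
  shows "(energy_grad has_derivative energy_hess F) (at F)"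
  unfolding energy_grad_def[abs_def] energy_hess_def[abs_def]
  using F by (intro matrix_mult.FDERIV bounded_linear.has_derivative[OF bounded_linear_transpose]
      matrix_inv_has_derivative dev_log_has_derivative) (auto simp: GL_plus_def)

lemma continuous_on_energy_hess: "continuous_on GL_plus (\<lambda>F :: real^'n^'n. energy_hess F H)"
proof -
  have tr: "continuous_on S f \<Longrightarrow> continuous_on S (\<lambda>x. transpose (f x))" for S and f :: "real^'n^'n \<Rightarrow> real^'n^'n"
    by (rule bounded_linear.continuous_on[OF bounded_linear_transpose])
  have "continuous_on GL_plus (dev_log :: real^'n^'n \<Rightarrow> _)"
    using dev_log_has_derivative has_derivative_continuous continuous_at_imp_continuous_on by blast
  moreover have "continuous_on GL_plus (\<lambda>F :: real^'n^'n. dev_log_deriv F H)"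
    unfolding dev_log_deriv_def
    by (intro bounded_linear.continuous_on[OF bounded_linear_dev] continuous_on_dlog_int continuous_intros
        matrix_mult.continuous_on tr) (auto intro: transpose_mult_self_pos_def)
  ultimately show ?thesis
    unfolding energy_hess_def
    by (intro continuous_intros matrix_mult.continuous_on tr) (auto simp: GL_plus_def)
qed

text \<open>On \<open>S\<close> the derivative is the Riesz image of \<open>g\<close>, a bounded
  linear function of it, and \<open>S\<close> is open, so it can be differentiated again. Finite
  dimension reduces continuity of the second derivative to single directions.\<close>

lemma C2_onI_gradient:
  fixes f :: "'a::euclidean_space \<Rightarrow> real"
  assumes S: "open S"
    and f: "\<And>x. x \<in> S \<Longrightarrow> (f has_derivative (\<lambda>h. g x \<bullet> h)) (at x)"
    and g: "\<And>x. x \<in> S \<Longrightarrow> (g has_derivative g' x) (at x)"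
    and cont: "\<And>h. continuous_on S (\<lambda>x. g' x h)"
  shows "C2_on f S" and "\<And>x h k. x \<in> S \<Longrightarrow> Deriv (Deriv f) x h k = g' x h \<bullet> k"
proof -
  have D: "Deriv f x = blinfun_inner_right (g x)" if "x \<in> S" for x
    unfolding Deriv_def frechet_derivative_at[OF f[OF that], symmetric]
    by (rule blinfun_eqI) (simp add: bounded_linear_Blinfun_apply bounded_linear_inner_right)
  have D2: "(Deriv f has_derivative (\<lambda>h. blinfun_inner_right (g' x h))) (at x)" if "x \<in> S" for x
    by (rule has_derivative_transform_within_open[OF
          bounded_linear.has_derivative[OF bounded_linear_blinfun_inner_right g[OF that]] S that])
      (simp add: D)
  have D3: "blinfun_apply (Deriv (Deriv f) x) = (\<lambda>h. blinfun_inner_right (g' x h))" if "x \<in> S" for x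
    unfolding Deriv_def[of "Deriv f"] frechet_derivative_at[OF D2[OF that], symmetric]
    by (rule bounded_linear_Blinfun_apply[OF has_derivative_bounded_linear[OF D2[OF that]]])
  show "Deriv (Deriv f) x h k = g' x h \<bullet> k" if "x \<in> S" for x h k
    by (simp add: D3[OF that])
  have c: "continuous_on S (\<lambda>x. Deriv (Deriv f) x h)" for h
    by (rule continuous_on_eq[OF bounded_linear.continuous_on[OF bounded_linear_blinfun_inner_right cont[of h]]])
      (simp add: D3)
  have "continuous_on S (Deriv (Deriv f))" by (rule continuous_on_blinfun_componentwise) (rule c)
  then show "C2_on f S"
    unfolding C2_on_def differentiable_def using f D2 by blast
qed

section \<open>The Hessian on rank one directions\<close>

lemma transpose_spectral_vector_mult:
  assumes "orthogonal_matrix Q"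
  shows "(transpose Q *v (spectral Q d *v x)) $ k = d k * (transpose Q *v x) $ k"
proof -
  have "transpose Q *v (spectral Q d *v x)
      = (transpose Q ** Q) *v ((\<chi> i j. if i = j then d i else 0) *v (transpose Q *v x))"
    by (simp add: spectral_def matrix_vector_mul_assoc matrix_mul_assoc del: transpose_matrix_vector)
  also have "\<dots> = (\<chi> i j. if i = j then d i else 0) *v (transpose Q *v x)"
    using assms by (simp add: orthogonal_matrix_def)
  finally show ?thesis
    by (simp add: matrix_vector_mult_def if_distrib [of "\<lambda>x. x * _"] cong: if_cong)
qed

text \<open>Since \<open>F^T \<xi>\<close> equals \<open>F^T F\<close> applied to
  \<open>F^-1 \<xi>\<close>, its coordinates are \<open>c i * a i\<close>. The three terms come from
  the derivative of the logarithm, from the trace part of \<open>dev\<close>, and from the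
  derivative of \<open>F^-T\<close>.\<close>

lemma energy_hess_rank_one:
  fixes F :: "real^'n^'n" and \<xi> \<eta> :: "real^'n"
  assumes F: "F \<in> GL_plus" and Q: "orthogonal_matrix Q" and c: "\<And>k. c k > 0"
    and FF: "transpose F ** F = spectral Q c"
  defines "a \<equiv> transpose Q *v (matrix_inv F *v \<xi>)" and "b \<equiv> transpose Q *v \<eta>"
    and "l \<equiv> \<lambda>k. ln (c k) - (\<Sum>k\<in>UNIV. ln (c k)) / real CARD('n)"
  shows "energy_hess F (outer_product \<xi> \<eta>) \<bullet> outer_product \<xi> \<eta> =
    (\<Sum>i\<in>UNIV. \<Sum>j\<in>UNIV. log_slope (c i) (c j) * (c i * (a $ i)\<^sup>2 * (b $ j)\<^sup>2 + c j * (a $ i * b $ i) * (a $ j * b $ j)))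
    - 2 / real CARD('n) * (\<Sum>k\<in>UNIV. a $ k * b $ k)\<^sup>2
    - (\<Sum>k\<in>UNIV. a $ k * b $ k) * (\<Sum>k\<in>UNIV. l k * (a $ k * b $ k))"
proof -
  let ?v = "matrix_inv F *v \<xi>" and ?H = "outer_product \<xi> \<eta>"
  let ?K = "outer_product (spectral Q c *v ?v) \<eta> + outer_product \<eta> (spectral Q c *v ?v)"
  let ?L = "dlog_int (spectral Q c)"
  have inv: "F ** matrix_inv F = mat 1" using F by (simp add: GL_plus_def matrix_inv_right)
  have GH: "matrix_inv F ** ?H = outer_product ?v \<eta>" by (rule matrix_mult_outer_product)
  \<comment> \<open>Moving \<open>F^-T\<close> across the inner product turns the rank one direction
    into \<open>F^-1 \<xi>\<close> paired with \<open>\<eta>\<close>.\<close>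
  have T: "(transpose (matrix_inv F) ** M) \<bullet> ?H = ?v \<bullet> (M *v \<eta>)" for M
    by (subst inner_matrix_mult_left) (simp add: transpose_transpose GH inner_outer_product)
  have "transpose F *v \<xi> = spectral Q c *v ?v"
    unfolding FF[symmetric] by (simp add: matrix_vector_mul_assoc inv flip: matrix_mul_assoc)
  then have K: "transpose F ** ?H + transpose ?H ** F = ?K"
    by (simp add: matrix_mult_outer_product outer_product_matrix_mult transpose_outer_product
        del: transpose_matrix_vector)
  have vb: "?v \<bullet> \<eta> = (\<Sum>k\<in>UNIV. a $ k * b $ k)"
    using inner_spectral_vector_mult[of ?v Q "\<lambda>_. 1" \<eta>] by (simp add: spectral_1[OF Q] a_def b_def)
  have a: "(transpose Q *v (spectral Q c *v ?v)) $ k = c k * a $ k" for k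
    unfolding a_def by (rule transpose_spectral_vector_mult[OF Q])
  have dl: "dev_log F = spectral Q l"
    by (simp add: dev_log_def FF log_int_spectral[OF Q c] dev_spectral[OF Q] l_def)
  have lin: "?L (A + B) = ?L A + ?L B" for A B
  proof -
    have "bounded_linear ?L"
      using log_int_has_derivative[OF PSym_imp_pos_def[OF spectral_pos_def[OF Q c]]]
      by (rule has_derivative_bounded_linear)
    then show ?thesis by (simp add: linear_add bounded_linear.linear)
  qed
  have "trace (?L ?K) = 2 * (\<Sum>k\<in>UNIV. a $ k * b $ k)"
  proof -
    have "1 / c k * (c k * a $ k * b $ k) = a $ k * b $ k" for k using c[of k] by simp
    then show ?thesis
      unfolding trace_dlog_int[OF Q c] inner_add_right inner_outer_product inner_spectral_vector_mult a
      by (simp add: b_def[symmetric] mult.commute[of "b $ _"] del: transpose_matrix_vector)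
  qed
  moreover have "?v \<bullet> (?L ?K *v \<eta>) = (\<Sum>i\<in>UNIV. \<Sum>j\<in>UNIV. log_slope (c i) (c j) *
      (c i * (a $ i)\<^sup>2 * (b $ j)\<^sup>2 + c j * (a $ i * b $ i) * (a $ j * b $ j)))"
    unfolding lin matrix_vector_mult_add_rdistrib inner_add_right
      inner_dlog_int_outer_product[OF Q c] a a_def[symmetric] b_def[symmetric] sum.distrib[symmetric]
    by (simp add: power2_eq_square algebra_simps)
  ultimately have 1: "(transpose (matrix_inv F) ** dev_log_deriv F ?H) \<bullet> ?H =
      (\<Sum>i\<in>UNIV. \<Sum>j\<in>UNIV. log_slope (c i) (c j) * (c i * (a $ i)\<^sup>2 * (b $ j)\<^sup>2 + c j * (a $ i * b $ i) * (a $ j * b $ j)))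
      - 2 / real CARD('n) * (\<Sum>k\<in>UNIV. a $ k * b $ k)\<^sup>2"
    unfolding T by (simp add: dev_log_deriv_def K FF dev_def matrix_vector_mult_diff_rdistrib inner_diff_right vb
        power2_eq_square flip: scaleR_matrix_vector_assoc)
  have 2: "(transpose (- (matrix_inv F ** ?H ** matrix_inv F)) ** dev_log F) \<bullet> ?H =
      - ((\<Sum>k\<in>UNIV. a $ k * b $ k) * (\<Sum>k\<in>UNIV. l k * (a $ k * b $ k)))"
  proof -
    have "transpose (- (matrix_inv F ** ?H ** matrix_inv F)) ** dev_log F
        = - (transpose (matrix_inv F) ** (outer_product \<eta> ?v ** dev_log F))"
      by (simp add: GH linear_neg[OF linear_transpose] matrix_transpose_mul transpose_outer_product
          matrix_mult.minus_left matrix_mul_assoc)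
    also have "\<dots> \<bullet> ?H = - (?v \<bullet> (outer_product \<eta> (dev_log F *v ?v) *v \<eta>))"
      unfolding inner_minus_left T by (simp add: outer_product_matrix_mult dl transpose_spectral)
    also have "\<dots> = - ((\<Sum>k\<in>UNIV. a $ k * b $ k) * (\<eta> \<bullet> (dev_log F *v ?v)))"
      by (simp add: outer_product_vector_mult vb[symmetric] inner_commute)
    also have "\<eta> \<bullet> (dev_log F *v ?v) = (\<Sum>k\<in>UNIV. l k * (a $ k * b $ k))"
      unfolding dl inner_spectral_vector_mult by (simp add: a_def b_def mult_ac)
    finally show ?thesis .
  qed
  show ?thesis unfolding energy_hess_def inner_add_left 1 2 by simp
qed

text \<open>The Hessian dominates \<open>ellipticity_form\<close> at the eigenvalues
  \<open>l i / 2\<close> and the products \<open>p i\<close>.\<close>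

lemma energy_hess_rank_one_nonneg:
  fixes F :: "real^3^3"
  assumes F: "F \<in> GL_plus" and bound: "(norm (dev_log F))\<^sup>2 / 4 \<le> 2/3"
  shows "0 \<le> energy_hess F (outer_product \<xi> \<eta>) \<bullet> outer_product \<xi> \<eta>"
proof -
  obtain Q c where Q: "orthogonal_matrix Q" "\<And>k. c k > 0" "transpose F ** F = spectral Q c"
    using F spectral_transpose_mult_self[of F] by (auto simp: GL_plus_def)
  define a b where "a = transpose Q *v (matrix_inv F *v \<xi>)" and "b = transpose Q *v \<eta>"
  define l where "l k = ln (c k) - (\<Sum>k\<in>UNIV. ln (c k)) / 3" for k
  define p where "p k = a $ k * b $ k" for k
  define s where "s = p 1 + p 2 + p 3"
  have dl: "dev_log F = spectral Q l"
    by (simp add: dev_log_def Q(3) log_int_spectral[OF Q(1,2)] dev_spectral[OF Q(1)] l_def[abs_def])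
  \<comment> \<open>The halves pass from the eigenvalues of \<open>dev_log F\<close> to those of the
    deviatoric logarithm of the stretch.\<close>
  have l0: "l 1 / 2 + l 2 / 2 + l 3 / 2 = 0" by (simp add: l_def sum_3 field_simps)
  have l2: "(l 1 / 2)\<^sup>2 + (l 2 / 2)\<^sup>2 + (l 3 / 2)\<^sup>2 \<le> 2/3"
    using bound by (simp add: dl norm_spectral[OF Q(1)] sum_3 power_divide)
  \<comment> \<open>The terms at \<open>(i, j)\<close> and \<open>(j, i)\<close> taken together;
    their slopes agree.\<close>
  define k where "k i j = log_slope (c i) (c j) * (c i * (a $ i)\<^sup>2 * (b $ j)\<^sup>2 +
      c j * (a $ j)\<^sup>2 * (b $ i)\<^sup>2 + (c i + c j) * (p i * p j))" for i j
  have pair: "pair_bound (l i / 2) (l j / 2) (p i * p j) \<le> k i j" for i j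
  proof -
    have "l i / 2 - l j / 2 = (ln (c i) - ln (c j)) / 2" by (simp add: l_def field_simps)
    then have "(l i / 2 - l j / 2)\<^sup>2 = ((ln (c i) - ln (c j)) / 2)\<^sup>2" by (simp only:)
    then show ?thesis
      using pair_term_bounds[OF Q(2)[of i] Q(2)[of j], of "a $ i" "b $ i" "a $ j" "b $ j"]
      unfolding pair_bound_def k_def p_def by (cases "0 \<le> p i * p j") (auto simp: p_def)
  qed
  define t where "t i j = log_slope (c i) (c j) * (c i * (a $ i)\<^sup>2 * (b $ j)\<^sup>2 + c j * p i * p j)" for i j
  \<comment> \<open>The diagonal slope \<open>1 / c i\<close> cancels \<open>c i\<close> in both
    summands.\<close>
  have diag: "t i i = 2 * (p i)\<^sup>2" for i
    using Q(2)[of i] by (simp add: t_def log_slope_def p_def power2_eq_square field_simps)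
  have off: "t i j + t j i = k i j" for i j
    unfolding t_def k_def log_slope_commute[of "c j" "c i"] by (simp add: algebra_simps)
  have "energy_hess F (outer_product \<xi> \<eta>) \<bullet> outer_product \<xi> \<eta> =
      (\<Sum>i\<in>UNIV. \<Sum>j\<in>UNIV. t i j)
      - 2/3 * s\<^sup>2 - s * (l 1 * p 1 + l 2 * p 2 + l 3 * p 3)"
    using energy_hess_rank_one[OF F Q, of \<xi> \<eta>]
    by (simp add: a_def[symmetric] b_def[symmetric] p_def s_def l_def t_def sum_3 del: transpose_matrix_vector)
  also have "(\<Sum>i\<in>UNIV. \<Sum>j\<in>UNIV. t i j)
      = 2 * ((p 1)\<^sup>2 + (p 2)\<^sup>2 + (p 3)\<^sup>2) + k 1 2 + k 1 3 + k 2 3"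
    by (simp only: sum_3 off[symmetric] distrib_left diag[symmetric] ac_simps)
  finally have "energy_hess F (outer_product \<xi> \<eta>) \<bullet> outer_product \<xi> \<eta> =
      2 * ((p 1)\<^sup>2 + (p 2)\<^sup>2 + (p 3)\<^sup>2) + k 1 2 + k 1 3 + k 2 3
      - 2/3 * s\<^sup>2 - s * (l 1 * p 1 + l 2 * p 2 + l 3 * p 3)" .
  moreover have "s * (l 1 * p 1 + l 2 * p 2 + l 3 * p 3)
      = 2 * s * (l 1 / 2 * p 1 + l 2 / 2 * p 2 + l 3 / 2 * p 3)" by (simp add: field_simps)
  ultimately show ?thesis
    using ellipticity_form_nonneg[OF l0 l2, of "p 1" "p 2" "p 3"] pair[of 1 2] pair[of 1 3] pair[of 2 3]
    unfolding ellipticity_form_def s_def by linarith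
qed

theorem proposition4p1:
  fixes W :: "real^3^3 \<Rightarrow> real" and E3 :: "(real^3^3) set"
  defines "W \<equiv> \<lambda>F. (norm (dev (mat_log (right_stretch F))))\<^sup>2"
    and "E3 \<equiv> {U \<in> PSym. (norm (dev (mat_log U)))\<^sup>2 \<le> 2 / 3}"
  shows "ellipticity_domain W (described_by E3) \<and>
         described_by E3 \<subseteq> maximal_ellipticity_domain W"
proof -
  \<comment> \<open>The two energies agree only on \<open>GL_plus\<close>; its openness transfers
    the derivative.\<close>
  have W: "(W has_derivative (\<lambda>H. energy_grad F \<bullet> H)) (at F)" if "F \<in> GL_plus" for F
    by (rule has_derivative_transform_within_open[OF energy_has_derivative[OF that] open_GL_plus that])
      (simp add: W_def norm_dev_mat_log_right_stretch)
  note C2 = C2_onI_gradient[OF open_GL_plus W energy_grad_has_derivative continuous_on_energy_hess]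
  have "legendre_hadamard_elliptic_at W F" if F: "F \<in> described_by E3" for F
  proof -
    have "F \<in> GL_plus" "(norm (dev_log F))\<^sup>2 / 4 \<le> 2/3"
      using F by (auto simp: described_by_def E3_def simp flip: norm_dev_mat_log_right_stretch)
    then show ?thesis
      using C2 by (simp add: legendre_hadamard_elliptic_at_def energy_hess_rank_one_nonneg)
  qed
  then show ?thesis
    by (auto simp: ellipticity_domain_def maximal_ellipticity_domain_def described_by_def)
qed

end
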